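(* Let $Q$ be a smooth manifold of dimension $m$, let $N=\{q\in Q\mid \phi^\alpha(q)=0,\ 1\le\alpha\le m-n\}$ be a submanifold of dimension $n<m$, where the $\phi^\alpha$ are smooth functions with differentials linearly independent at the points of $N$, and let $i_N\colon N\hookrightarrow Q$ be the inclusion. Let $L\colon TN\to\mathbb{R}$ be a regular Lagrangian and let $\tilde L\colon TQ\to\mathbb{R}$ be an arbitrary smooth extension of $L$, i.e. $\tilde L|_{TN}=L$. Then the intrinsic dynamics of $L$ on $N$ and the extrinsic dynamics of $\tilde L$ with holonomic constraints $\phi^\alpha=0$ are equivalent, i.e. they have the same solution curves: a smooth curve $x\colon I\to N$ satisfies the Euler--Lagrange equations $$\frac{d}{dt}\left(\frac{\partial L}{\partial\dot x^a}\right)-\frac{\partial L}{\partial x^a}=0,\qquad 1\le a\le n,$$ in local coordinates of $N$ if and only if there exist Lagrange multipliers $\Lambda_\alpha$ (functions of $t$ along the curve) such that the curve $q=i_N\circ x$ in $Q$ satisfies, in local coordinates of $Q$, $$\frac{d}{dt}\left(\frac{\partial\tilde L}{\partial\dot q^i}\right)-\frac{\partial\tilde L}{\partial q^i}=-\Lambda_\alpha\frac{\partial\phi^\alpha}{\partial q^i},\quad 1\le i\le m,\qquad \phi^\alpha(q)=0 .$$ Moreover, every curve in $Q$ solving the latter system is of the form $i_N\circ x$ for a curve $x$ in $N$.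
   Context: Summation over repeated indices is understood. A Lagrangian $L\colon TN\to\mathbb{R}$ is regular if its fibre Hessian $\left(\partial^2L/\partial\dot x^a\partial\dot x^b\right)$ is everywhere nondegenerate. $TN$ is regarded as a submanifold of $TQ$ via $Ti_N$. All derivatives of $L$ and $\tilde L$ are evaluated along the curve and its velocity. *)

theory Defs
  imports "HOL-Analysis.Analysis"
begin

section \<open>Smooth functions and partial derivatives in Euclidean spaces\<close>

primrec times_differentiable_on ::
  "nat \<Rightarrow> 'a::real_normed_vector set \<Rightarrow> ('a \<Rightarrow> 'b::real_normed_vector) \<Rightarrow> bool" where
  "times_differentiable_on 0 S f \<longleftrightarrow> continuous_on S f"
| "times_differentiable_on (Suc k) S f \<longleftrightarrow>
     (\<forall>x\<in>S. f differentiable (at x)) \<and>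
     (\<forall>h. times_differentiable_on k S (\<lambda>x. frechet_derivative f (at x) h))"

text \<open>Used only for open \<open>S\<close>.\<close>

definition smooth_on :: "'a::real_normed_vector set \<Rightarrow> ('a \<Rightarrow> 'b::real_normed_vector) \<Rightarrow> bool"
  where "smooth_on S f \<longleftrightarrow> (\<forall>k. times_differentiable_on k S f)"

text \<open>Smoothness of a path on a set \<open>J\<close> that is relatively open in a nondegenerate interval;
  derivatives are one-sided at the end points belonging to \<open>J\<close>.\<close>

definition smooth_path_on :: "real set \<Rightarrow> (real \<Rightarrow> 'a::real_normed_vector) \<Rightarrow> bool"
  where "smooth_path_on J f \<longleftrightarrow>
    (\<exists>D :: nat \<Rightarrow> real \<Rightarrow> 'a. (\<forall>t\<in>J. D 0 t = f t) \<and>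
       (\<forall>k. \<forall>t\<in>J. (D k has_vector_derivative D (Suc k) t) (at t within J)))"

definition partial :: "'d::finite \<Rightarrow> (real^'d \<Rightarrow> real) \<Rightarrow> real^'d \<Rightarrow> real"
  where "partial i f x = deriv (\<lambda>s. f (x + s *\<^sub>R axis i 1)) 0"


section \<open>Smooth manifolds\<close>

text \<open>A chart \<open>(U, \<psi>)\<close> consists of its domain and its coordinate map; the values of \<open>\<psi>\<close> outside
  \<open>U\<close> are irrelevant.\<close>

type_synonym ('q, 'd) chart = "'q set \<times> ('q \<Rightarrow> real^'d)"

abbreviation dom_of :: "('q, 'd::finite) chart \<Rightarrow> 'q set"
  where "dom_of c \<equiv> fst c"

abbreviation coords :: "('q, 'd::finite) chart \<Rightarrow> 'q \<Rightarrow> real^'d"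
  where "coords c \<equiv> snd c"

definition chart_inv :: "('q, 'd::finite) chart \<Rightarrow> real^'d \<Rightarrow> 'q"
  where "chart_inv c = inv_into (dom_of c) (coords c)"

text \<open>A manifold is a subset \<open>M\<close> of a Hausdorff, second countable space, with the subspace
  topology (\<open>M = UNIV\<close> is allowed), and a smooth atlas \<open>A\<close>. The atlas is not required to be maximal,
  but it may be, in which case its members are all the local coordinate systems of \<open>M\<close>.\<close>

definition smooth_manifold ::
  "'q::{t2_space,second_countable_topology} set \<Rightarrow> ('q, 'd::finite) chart set \<Rightarrow> bool"
  where "smooth_manifold M A \<longleftrightarrow>
    (\<Union>c\<in>A. dom_of c) = M \<and>
    (\<forall>c\<in>A. openin (top_of_set M) (dom_of c) \<and> open (coords c ` dom_of c) \<and>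
       homeomorphism (dom_of c) (coords c ` dom_of c) (coords c) (chart_inv c)) \<and>
    (\<forall>c\<in>A. \<forall>c'\<in>A. smooth_on (coords c ` (dom_of c \<inter> dom_of c')) (coords c' \<circ> chart_inv c))"

definition smooth_function :: "('q, 'd::finite) chart set \<Rightarrow> ('q \<Rightarrow> real) \<Rightarrow> bool"
  where "smooth_function A f \<longleftrightarrow> (\<forall>c\<in>A. smooth_on (coords c ` dom_of c) (f \<circ> chart_inv c))"

definition smooth_map ::
  "'p::topological_space set \<Rightarrow> ('p, 'd::finite) chart set \<Rightarrow>
   'q::topological_space set \<Rightarrow> ('q, 'e::finite) chart set \<Rightarrow> ('p \<Rightarrow> 'q) \<Rightarrow> bool"
  where "smooth_map M A M' A' f \<longleftrightarrow>
    f ` M \<subseteq> M' \<and> continuous_on M f \<and>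
    (\<forall>c\<in>A. \<forall>c'\<in>A'. smooth_on (coords c ` (dom_of c \<inter> f -` dom_of c')) (coords c' \<circ> f \<circ> chart_inv c))"

definition smooth_curve ::
  "'q::topological_space set \<Rightarrow> ('q, 'd::finite) chart set \<Rightarrow> real set \<Rightarrow> (real \<Rightarrow> 'q) \<Rightarrow> bool"
  where "smooth_curve M A I x \<longleftrightarrow>
    x ` I \<subseteq> M \<and> continuous_on I x \<and>
    (\<forall>c\<in>A. smooth_path_on (I \<inter> x -` dom_of c) (coords c \<circ> x))"


section \<open>Tangent vectors\<close>

text \<open>A tangent vector at \<open>p\<close> is given by its component vectors with respect to all charts of the
  atlas around \<open>p\<close>, related by the Jacobians of the chart transitions. (The components for
  all other pairs are set to zero, so that tangent vectors are determined by their components.)\<close>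

type_synonym ('q, 'd) tangent_vector = "'q \<times> (('q, 'd) chart \<Rightarrow> real^'d)"

definition tangent_space :: "('q, 'd::finite) chart set \<Rightarrow> 'q \<Rightarrow> ('q, 'd) tangent_vector set"
  where "tangent_space A p = {(p', v). p' = p \<and>
    (\<forall>c\<in>A. \<forall>c'\<in>A. p \<in> dom_of c \<and> p \<in> dom_of c' \<longrightarrow>
       v c' = frechet_derivative (coords c' \<circ> chart_inv c) (at (coords c p)) (v c)) \<and>
    (\<forall>c. \<not> (c \<in> A \<and> p \<in> dom_of c) \<longrightarrow> v c = 0)}"

definition tangent_bundle :: "'q set \<Rightarrow> ('q, 'd::finite) chart set \<Rightarrow> ('q, 'd) tangent_vector set"
  where "tangent_bundle M A = (\<Union>p\<in>M. tangent_space A p)"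

text \<open>The tangent vector at \<open>p\<close> whose components with respect to the chart \<open>c\<close> are \<open>w\<close>.\<close>

definition tangent_at ::
  "('q, 'd::finite) chart set \<Rightarrow> ('q, 'd) chart \<Rightarrow> 'q \<Rightarrow> real^'d \<Rightarrow> ('q, 'd) tangent_vector"
  where "tangent_at A c p w = (p, \<lambda>c'. if c' \<in> A \<and> p \<in> dom_of c'
    then frechet_derivative (coords c' \<circ> chart_inv c) (at (coords c p)) w else 0)"

definition some_chart :: "('q, 'd::finite) chart set \<Rightarrow> 'q \<Rightarrow> ('q, 'd) chart"
  where "some_chart A p = (SOME c. c \<in> A \<and> p \<in> dom_of c)"

text \<open>The differential \<open>df\<close> of a real function and the tangent map \<open>Tf\<close> of a map, both
  independent of the charts chosen in the domain.\<close>

definition differential ::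
  "('q, 'd::finite) chart set \<Rightarrow> ('q \<Rightarrow> real) \<Rightarrow> ('q, 'd) tangent_vector \<Rightarrow> real"
  where "differential A f X = (let p = fst X; c = some_chart A p in
    frechet_derivative (f \<circ> chart_inv c) (at (coords c p)) (snd X c))"

definition tangent_map ::
  "('p, 'd::finite) chart set \<Rightarrow> ('q, 'e::finite) chart set \<Rightarrow> ('p \<Rightarrow> 'q) \<Rightarrow>
   ('p, 'd) tangent_vector \<Rightarrow> ('q, 'e) tangent_vector"
  where "tangent_map A A' f X = (let p = fst X; c = some_chart A p in
    (f p, \<lambda>c'. if c' \<in> A' \<and> f p \<in> dom_of c'
       then frechet_derivative (coords c' \<circ> f \<circ> chart_inv c) (at (coords c p)) (snd X c) else 0))"

definition differentials_independent_at ::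
  "('q, 'd::finite) chart set \<Rightarrow> ('k::finite \<Rightarrow> 'q \<Rightarrow> real) \<Rightarrow> 'q \<Rightarrow> bool"
  where "differentials_independent_at A \<phi> p \<longleftrightarrow>
    (\<forall>a :: 'k \<Rightarrow> real. (\<forall>X\<in>tangent_space A p. (\<Sum>\<alpha>\<in>UNIV. a \<alpha> * differential A (\<phi> \<alpha>) X) = 0)
       \<longrightarrow> (\<forall>\<alpha>. a \<alpha> = 0))"

text \<open>Embedded submanifolds. As \<open>N \<subseteq> Q\<close> are sets of the same type, the inclusion map is \<open>id\<close>; it is
  a topological embedding because \<open>smooth_manifold N AN\<close> refers to the subspace topology.\<close>

definition submanifold ::
  "'q::{t2_space,second_countable_topology} set \<Rightarrow> ('q, 'n::finite) chart set \<Rightarrow>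
   'q set \<Rightarrow> ('q, 'm::finite) chart set \<Rightarrow> bool"
  where "submanifold N AN Q AQ \<longleftrightarrow>
    smooth_manifold N AN \<and> N \<subseteq> Q \<and> smooth_map N AN Q AQ id \<and>
    (\<forall>p\<in>N. inj_on (tangent_map AN AQ id) (tangent_space AN p))"


section \<open>Lagrangians and Euler--Lagrange equations\<close>

text \<open>The expression of \<open>L\<close> in the coordinates (position, velocity) of the tangent bundle induced by
  the chart \<open>c\<close>.\<close>

definition lagrangian_in ::
  "('q, 'd::finite) chart set \<Rightarrow> (('q, 'd) tangent_vector \<Rightarrow> real) \<Rightarrow> ('q, 'd) chart \<Rightarrow>
   (real^'d) \<times> (real^'d) \<Rightarrow> real"
  where "lagrangian_in A L c = (\<lambda>(q, v). L (tangent_at A c (chart_inv c q) v))"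

definition smooth_lagrangian ::
  "('q, 'd::finite) chart set \<Rightarrow> (('q, 'd) tangent_vector \<Rightarrow> real) \<Rightarrow> bool"
  where "smooth_lagrangian A L \<longleftrightarrow>
    (\<forall>c\<in>A. smooth_on ((coords c ` dom_of c) \<times> UNIV) (lagrangian_in A L c))"

definition partial_pos :: "'d::finite \<Rightarrow> ((real^'d) \<times> (real^'d) \<Rightarrow> real) \<Rightarrow> (real^'d) \<times> (real^'d) \<Rightarrow> real"
  where "partial_pos i l = (\<lambda>(q, v). partial i (\<lambda>q'. l (q', v)) q)"

definition partial_vel :: "'d::finite \<Rightarrow> ((real^'d) \<times> (real^'d) \<Rightarrow> real) \<Rightarrow> (real^'d) \<times> (real^'d) \<Rightarrow> real"
  where "partial_vel i l = (\<lambda>(q, v). partial i (\<lambda>v'. l (q, v')) v)"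

definition fibre_hessian :: "((real^'d::finite) \<times> (real^'d) \<Rightarrow> real) \<Rightarrow> (real^'d) \<times> (real^'d) \<Rightarrow> real^'d^'d"
  where "fibre_hessian l z = (\<chi> a b. partial_vel a (partial_vel b l) z)"

definition regular_lagrangian ::
  "('q, 'd::finite) chart set \<Rightarrow> (('q, 'd) tangent_vector \<Rightarrow> real) \<Rightarrow> bool"
  where "regular_lagrangian A L \<longleftrightarrow> smooth_lagrangian A L \<and>
    (\<forall>c\<in>A. \<forall>z \<in> (coords c ` dom_of c) \<times> UNIV. det (fibre_hessian (lagrangian_in A L c) z) \<noteq> 0)"

text \<open>The curve in coordinates together with its coordinate velocity, in the chart \<open>c\<close>. All time
  derivatives are taken within \<open>I\<close>, i.e. they are one-sided at end points belonging to \<open>I\<close>.\<close>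

definition lifted_curve ::
  "('q, 'd::finite) chart \<Rightarrow> real set \<Rightarrow> (real \<Rightarrow> 'q) \<Rightarrow> real \<Rightarrow> (real^'d) \<times> (real^'d)"
  where "lifted_curve c I x t =
    (coords c (x t), vector_derivative (coords c \<circ> x) (at t within I))"

definition euler_lagrange ::
  "('q, 'd::finite) chart set \<Rightarrow> (('q, 'd) tangent_vector \<Rightarrow> real) \<Rightarrow> ('q, 'd) chart \<Rightarrow>
   real set \<Rightarrow> (real \<Rightarrow> 'q) \<Rightarrow> real \<Rightarrow> 'd \<Rightarrow> real"
  where "euler_lagrange A L c I x t i =
    vector_derivative (\<lambda>s. partial_vel i (lagrangian_in A L c) (lifted_curve c I x s)) (at t within I)
    - partial_pos i (lagrangian_in A L c) (lifted_curve c I x t)"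

definition intrinsic_solution ::
  "('q, 'd::finite) chart set \<Rightarrow> (('q, 'd) tangent_vector \<Rightarrow> real) \<Rightarrow> real set \<Rightarrow> (real \<Rightarrow> 'q) \<Rightarrow> bool"
  where "intrinsic_solution A L I x \<longleftrightarrow>
    (\<forall>c\<in>A. \<forall>t\<in>I. x t \<in> dom_of c \<longrightarrow> (\<forall>i. euler_lagrange A L c I x t i = 0))"

definition extrinsic_solution ::
  "('q, 'd::finite) chart set \<Rightarrow> (('q, 'd) tangent_vector \<Rightarrow> real) \<Rightarrow> ('k::finite \<Rightarrow> 'q \<Rightarrow> real) \<Rightarrow>
   real set \<Rightarrow> ('k \<Rightarrow> real \<Rightarrow> real) \<Rightarrow> (real \<Rightarrow> 'q) \<Rightarrow> bool"
  where "extrinsic_solution A L \<phi> I \<Lambda> q \<longleftrightarrow>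
    (\<forall>c\<in>A. \<forall>t\<in>I. q t \<in> dom_of c \<longrightarrow>
       (\<forall>i. euler_lagrange A L c I q t i =
          - (\<Sum>\<alpha>\<in>UNIV. \<Lambda> \<alpha> t * partial i (\<phi> \<alpha> \<circ> chart_inv c) (coords c (q t))))) \<and>
    (\<forall>t\<in>I. \<forall>\<alpha>. \<phi> \<alpha> (q t) = 0)"

end

theory Submission
  imports Defs
begin

text \<open>
  Fix a chart \<open>c\<close> of \<open>N\<close>, a chart \<open>c'\<close> of \<open>Q\<close>, and let \<open>F\<close> be the inclusion in these coordinates. The
  hypothesis on the extension reads \<open>l (y, v) = l' (F y, DF y v)\<close> for the coordinate expressions of
  the two Lagrangians. Differentiating this identity along a curve and using that \<open>D(DF h) k\<close> is
  symmetric in \<open>h\<close> and \<open>k\<close>, the second derivatives of \<open>F\<close> cancel, and the Euler--Lagrange covector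
  of \<open>l\<close> is the pullback by \<open>DF\<close> of that of \<open>l'\<close>
  (\<open>coordinate_euler_lagrange_related\<close>, \<open>euler_lagrange_chart_change\<close>). So a curve in \<open>N\<close> solves the
  intrinsic equations iff the extrinsic Euler--Lagrange covector annihilates the tangent space of
  \<open>N\<close>. The differentials of the \<open>\<phi>\<^sup>\<alpha>\<close> annihilate it as well because the \<open>\<phi>\<^sup>\<alpha>\<close> vanish on \<open>N\<close>; they are
  independent, and their number is the dimension of the annihilator. Hence they span it
  (\<open>in_span_of_annihilator\<close>), and annihilating the tangent space amounts to the existence of
  multipliers.

  The multipliers are found at each time in one chart of \<open>Q\<close>. They serve all other charts, since
  both sides of the extrinsic equation transform as covectors: for the left-hand side this is the
  pullback formula again, applied to a chart transition of \<open>Q\<close> in place of the inclusion.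

  Finally, an extrinsic solution lies in \<open>N\<close> by the constraint equations; what needs proof is that
  it is smooth as a curve in \<open>N\<close> (\<open>smooth_curve_in_submanifold_iff\<close>). If \<open>F \<circ> u\<close> is smooth, \<open>u\<close> is
  continuous, and \<open>DF\<close> is injective, then \<open>u\<close> is differentiable and \<open>u'\<close> is the solution of the
  linear equation \<open>DF u' = (F \<circ> u)'\<close>. By Cramer's rule \<open>u'\<close> is as often differentiable as \<open>u\<close>, which
  gives smoothness by induction.
\<close>

section \<open>Smooth functions and symmetry of second derivatives\<close>

lemma smooth_on_has_derivative:
  assumes "smooth_on S f" "x \<in> S"
  shows "(f has_derivative frechet_derivative f (at x)) (at x)"
proof -
  have "times_differentiable_on (Suc 0) S f" using assms by (simp only: smooth_on_def)
  with assms(2) have "f differentiable (at x)" by simp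
  then show ?thesis by (simp add: frechet_derivative_works)
qed

lemma smooth_on_frechet_derivative:
  assumes "smooth_on S f"
  shows "smooth_on S (\<lambda>x. frechet_derivative f (at x) h)"
  unfolding smooth_on_def
proof
  fix k
  have "times_differentiable_on (Suc k) S f" using assms by (simp only: smooth_on_def)
  then show "times_differentiable_on k S (\<lambda>x. frechet_derivative f (at x) h)" by simp
qed

lemma smooth_on_imp_continuous_on:
  assumes "smooth_on S f"
  shows "continuous_on S f"
proof -
  have "times_differentiable_on 0 S f" using assms by (simp only: smooth_on_def)
  then show ?thesis by simp
qed

text \<open>The mean value theorem is applied to \<open>a \<mapsto> f (x + a h + t k) - f (x + a h)\<close>, and then to
  \<open>b \<mapsto> D (x + a h + b k) h\<close>. The left-hand side is symmetric in \<open>h\<close> and \<open>k\<close>, the right-hand side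
  a priori not.\<close>

lemma second_difference_mean_value:
  fixes f :: "'a::real_normed_vector \<Rightarrow> real"
  assumes D: "\<And>y. y \<in> S \<Longrightarrow> (f has_derivative D y) (at y)"
    and H: "\<And>y. y \<in> S \<Longrightarrow> ((\<lambda>y. D y h) has_derivative H y) (at y)"
    and "0 < t"
    and S: "\<And>a b. 0 \<le> a \<Longrightarrow> a \<le> t \<Longrightarrow> 0 \<le> b \<Longrightarrow> b \<le> t \<Longrightarrow> x + a *\<^sub>R h + b *\<^sub>R k \<in> S"
  shows "\<exists>a b. 0 \<le> a \<and> a \<le> t \<and> 0 \<le> b \<and> b \<le> t \<and>
    f (x + t *\<^sub>R h + t *\<^sub>R k) - f (x + t *\<^sub>R h) - f (x + t *\<^sub>R k) + f x
      = t * t * H (x + a *\<^sub>R h + b *\<^sub>R k) k"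
proof -
  have f': "((\<lambda>a. f (x + a *\<^sub>R h + b *\<^sub>R k)) has_real_derivative D (x + a *\<^sub>R h + b *\<^sub>R k) h) (at a)"
    if "0 \<le> a" "a \<le> t" "0 \<le> b" "b \<le> t" for a b
  proof -
    have "((\<lambda>a. f (x + a *\<^sub>R h + b *\<^sub>R k)) has_derivative
            (\<lambda>s. D (x + a *\<^sub>R h + b *\<^sub>R k) (s *\<^sub>R h))) (at a)"
      by (rule has_derivative_compose[where g = f and f = "\<lambda>a. x + a *\<^sub>R h + b *\<^sub>R k" and x = a, OF _ D[OF S[OF that]]]) (auto intro!: derivative_eq_intros)
    moreover have "linear (D (x + a *\<^sub>R h + b *\<^sub>R k))"
      using D[OF S[OF that]] by (rule has_derivative_linear)
    ultimately show ?thesis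
      by (simp add: has_field_derivative_def linear_cmul mult.commute[of _ "D _ h"])
  qed
  define g where "g a = f (x + a *\<^sub>R h + t *\<^sub>R k) - f (x + a *\<^sub>R h)" for a
  have "\<exists>a. 0 < a \<and> a < t \<and>
      g t - g 0 = (t - 0) * (D (x + a *\<^sub>R h + t *\<^sub>R k) h - D (x + a *\<^sub>R h) h)"
  proof (rule MVT2[OF \<open>0 < t\<close>])
    fix a assume a: "0 \<le> a" "a \<le> t"
    show "(g has_real_derivative D (x + a *\<^sub>R h + t *\<^sub>R k) h - D (x + a *\<^sub>R h) h) (at a)"
      unfolding g_def using f'[of a t] f'[of a 0] a \<open>0 < t\<close> by (auto intro: DERIV_diff)
  qed
  then obtain a where a: "0 < a" "a < t"
    "g t - g 0 = (t - 0) * (D (x + a *\<^sub>R h + t *\<^sub>R k) h - D (x + a *\<^sub>R h) h)"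
    by blast
  have "\<exists>b. 0 < b \<and> b < t \<and> D (x + a *\<^sub>R h + t *\<^sub>R k) h - D (x + a *\<^sub>R h + 0 *\<^sub>R k) h
      = (t - 0) * H (x + a *\<^sub>R h + b *\<^sub>R k) k"
  proof (rule MVT2[OF \<open>0 < t\<close>])
    fix b assume b: "0 \<le> b" "b \<le> t"
    with a have in_S: "x + a *\<^sub>R h + b *\<^sub>R k \<in> S" by (intro S) auto
    have "((\<lambda>b. D (x + a *\<^sub>R h + b *\<^sub>R k) h) has_derivative
            (\<lambda>s. H (x + a *\<^sub>R h + b *\<^sub>R k) (s *\<^sub>R k))) (at b)"
      by (rule has_derivative_compose[where g = "\<lambda>y. D y h" and f = "\<lambda>b. x + a *\<^sub>R h + b *\<^sub>R k" and x = b, OF _ H[OF in_S]]) (auto intro!: derivative_eq_intros)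
    moreover have "linear (H (x + a *\<^sub>R h + b *\<^sub>R k))"
      using H[OF in_S] by (rule has_derivative_linear)
    ultimately show "((\<lambda>b. D (x + a *\<^sub>R h + b *\<^sub>R k) h) has_real_derivative
        H (x + a *\<^sub>R h + b *\<^sub>R k) k) (at b)"
      by (simp add: has_field_derivative_def linear_cmul mult.commute[of _ "H _ k"])
  qed
  then obtain b where b: "0 < b" "b < t"
    "D (x + a *\<^sub>R h + t *\<^sub>R k) h - D (x + a *\<^sub>R h + 0 *\<^sub>R k) h = (t - 0) * H (x + a *\<^sub>R h + b *\<^sub>R k) k"
    by blast
  show ?thesis
    using a b by (intro exI[of _ a] exI[of _ b]) (simp add: g_def algebra_simps)
qed

text \<open>Both mixed derivatives take, at suitable points near \<open>x\<close>, the value of the same second difference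
  quotient. If they differed at \<open>x\<close>, continuity would keep them apart near \<open>x\<close>.\<close>

lemma symmetric_second_derivative_real:
  fixes f :: "'a::real_normed_vector \<Rightarrow> real"
  assumes S: "open S" "x \<in> S"
    and D: "\<And>y. y \<in> S \<Longrightarrow> (f has_derivative D y) (at y)"
    and H: "\<And>h y. y \<in> S \<Longrightarrow> ((\<lambda>y. D y h) has_derivative H h y) (at y)"
    and cont: "\<And>h k. continuous_on S (\<lambda>y. H h y k)"
  shows "H h x k = H k x h"
proof (rule ccontr)
  assume neq: "H h x k \<noteq> H k x h"
  define e where "e = \<bar>H h x k - H k x h\<bar> / 2"
  have "e > 0" using neq by (simp add: e_def)
  have near: "\<exists>d>0. \<forall>y. dist y x < d \<longrightarrow> y \<in> S \<and> \<bar>H u y v - H u x v\<bar> < e" for u v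
  proof -
    have "isCont (\<lambda>y. H u y v) x"
      using cont S by (simp add: continuous_on_eq_continuous_at)
    then have "((\<lambda>y. H u y v) \<longlongrightarrow> H u x v) (nhds x)"
      by (simp only: continuous_at tendsto_at_iff_tendsto_nhds[of "\<lambda>y. H u y v"])
    then have "eventually (\<lambda>y. dist (H u y v) (H u x v) < e) (nhds x)"
      using \<open>e > 0\<close> by (rule tendstoD)
    moreover have "eventually (\<lambda>y. y \<in> S) (nhds x)"
      using S by (rule eventually_nhds_in_open)
    ultimately have "eventually (\<lambda>y. y \<in> S \<and> \<bar>H u y v - H u x v\<bar> < e) (nhds x)"
      by eventually_elim (simp add: dist_real_def)
    then show ?thesis by (simp add: eventually_nhds_metric)
  qed
  obtain d1 where d1: "d1 > 0" "\<And>y. dist y x < d1 \<Longrightarrow> y \<in> S \<and> \<bar>H h y k - H h x k\<bar> < e"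
    using near by blast
  obtain d2 where d2: "d2 > 0" "\<And>y. dist y x < d2 \<Longrightarrow> y \<in> S \<and> \<bar>H k y h - H k x h\<bar> < e"
    using near by blast
  \<comment> \<open>All points that occur in the second difference of step \<open>t\<close> are closer to \<open>x\<close> than both radii. The
    summand \<open>1\<close> in \<open>c\<close> covers the case that \<open>h\<close> and \<open>k\<close> vanish.\<close>
  define c where "c = norm h + norm k + 1"
  define t where "t = min d1 d2 / 2 / c"
  have pos: "c > 0" unfolding c_def by (meson add_nonneg_pos norm_ge_zero add_nonneg_nonneg zero_less_one)
  have "t > 0" using d1 d2 pos by (simp add: t_def)
  have close: "dist (x + a *\<^sub>R u + b *\<^sub>R v) x < min d1 d2"
    if "0 \<le> a" "a \<le> t" "0 \<le> b" "b \<le> t" "norm u + norm v = norm h + norm k" for a b u v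
  proof -
    have "dist (x + a *\<^sub>R u + b *\<^sub>R v) x \<le> a * norm u + b * norm v"
      using that by (simp add: dist_norm norm_triangle_le)
    also have "\<dots> \<le> t * norm u + t * norm v"
      using that by (intro add_mono mult_right_mono) auto
    also have "\<dots> \<le> t * c"
      using that \<open>t > 0\<close> by (simp add: c_def flip: distrib_left)
    also have "\<dots> = min d1 d2 / 2" using pos by (simp add: t_def)
    also have "\<dots> < min d1 d2" using d1(1) d2(1) by linarith
    finally show ?thesis .
  qed
  have "\<exists>a b. 0 \<le> a \<and> a \<le> t \<and> 0 \<le> b \<and> b \<le> t \<and>
    f (x + t *\<^sub>R h + t *\<^sub>R k) - f (x + t *\<^sub>R h) - f (x + t *\<^sub>R k) + f x
      = t * t * H h (x + a *\<^sub>R h + b *\<^sub>R k) k"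
    using close d1(2) by (intro second_difference_mean_value[OF D H \<open>t > 0\<close>]) auto
  then obtain a b where ab: "0 \<le> a" "a \<le> t" "0 \<le> b" "b \<le> t"
    "f (x + t *\<^sub>R h + t *\<^sub>R k) - f (x + t *\<^sub>R h) - f (x + t *\<^sub>R k) + f x
      = t * t * H h (x + a *\<^sub>R h + b *\<^sub>R k) k" by blast
  have "\<exists>a b. 0 \<le> a \<and> a \<le> t \<and> 0 \<le> b \<and> b \<le> t \<and>
    f (x + t *\<^sub>R k + t *\<^sub>R h) - f (x + t *\<^sub>R k) - f (x + t *\<^sub>R h) + f x
      = t * t * H k (x + a *\<^sub>R k + b *\<^sub>R h) h"
    using close[of _ _ k h] d1(2) by (intro second_difference_mean_value[OF D H \<open>t > 0\<close>]) auto
  then obtain a' b' where ab': "0 \<le> a'" "a' \<le> t" "0 \<le> b'" "b' \<le> t"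
    "f (x + t *\<^sub>R k + t *\<^sub>R h) - f (x + t *\<^sub>R k) - f (x + t *\<^sub>R h) + f x
      = t * t * H k (x + a' *\<^sub>R k + b' *\<^sub>R h) h" by blast
  have "t * t * H h (x + a *\<^sub>R h + b *\<^sub>R k) k = t * t * H k (x + a' *\<^sub>R k + b' *\<^sub>R h) h"
    using ab(5) ab'(5) by (simp add: algebra_simps)
  then have eq: "H h (x + a *\<^sub>R h + b *\<^sub>R k) k = H k (x + a' *\<^sub>R k + b' *\<^sub>R h) h"
    using \<open>t > 0\<close> by simp
  have "\<bar>H h (x + a *\<^sub>R h + b *\<^sub>R k) k - H h x k\<bar> < e"
    using d1(2) close[of a b h k] ab by simp
  moreover have "\<bar>H k (x + a' *\<^sub>R k + b' *\<^sub>R h) h - H k x h\<bar> < e"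
    using d2(2) close[of a' b' k h] ab' by simp
  ultimately have "\<bar>H h x k - H k x h\<bar> < 2 * e" unfolding eq by linarith
  then show False by (simp add: e_def)
qed

lemma smooth_on_symmetric_second_derivative:
  fixes f :: "'a::real_normed_vector \<Rightarrow> 'b::euclidean_space"
  assumes S: "open S" "x \<in> S" and f: "smooth_on S f"
  shows "frechet_derivative (\<lambda>y. frechet_derivative f (at y) h) (at x) k
       = frechet_derivative (\<lambda>y. frechet_derivative f (at y) k) (at x) h"
proof (rule euclidean_eqI)
  fix b :: 'b
  note f' = smooth_on_frechet_derivative[OF f] and f'' = smooth_on_frechet_derivative[OF smooth_on_frechet_derivative[OF f]]
  show "frechet_derivative (\<lambda>y. frechet_derivative f (at y) h) (at x) k \<bullet> b
      = frechet_derivative (\<lambda>y. frechet_derivative f (at y) k) (at x) h \<bullet> b"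
    using S
  proof (rule symmetric_second_derivative_real[where f = "\<lambda>y. f y \<bullet> b"
        and D = "\<lambda>y h. frechet_derivative f (at y) h \<bullet> b"
        and H = "\<lambda>h y k. frechet_derivative (\<lambda>y. frechet_derivative f (at y) h) (at y) k \<bullet> b"])
    fix y assume "y \<in> S"
    show "((\<lambda>y. f y \<bullet> b) has_derivative (\<lambda>h. frechet_derivative f (at y) h \<bullet> b)) (at y)"
      by (rule has_derivative_inner_left[OF smooth_on_has_derivative[OF f \<open>y \<in> S\<close>]])
    show "((\<lambda>y. frechet_derivative f (at y) h \<bullet> b) has_derivative
      (\<lambda>k. frechet_derivative (\<lambda>y. frechet_derivative f (at y) h) (at y) k \<bullet> b)) (at y)" for h
      by (rule has_derivative_inner_left[OF smooth_on_has_derivative[OF f' \<open>y \<in> S\<close>]])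
  next
    show "continuous_on S (\<lambda>y. frechet_derivative (\<lambda>y. frechet_derivative f (at y) h) (at y) k \<bullet> b)" for h k
      by (intro continuous_on_inner smooth_on_imp_continuous_on[OF f''] continuous_on_const)
  qed
qed

section \<open>Euler--Lagrange expressions of related Lagrangians\<close>

lemma partial_eq_derivative:
  assumes "(f has_derivative D) (at x)"
  shows "partial i f x = D (axis i 1)"
proof -
  have lin: "linear D" using assms by (rule has_derivative_linear)
  have "((\<lambda>s. f (x + s *\<^sub>R axis i 1)) has_derivative (\<lambda>s. D (s *\<^sub>R axis i 1))) (at 0)"
    by (rule has_derivative_compose[where g = f and f = "\<lambda>s. x + s *\<^sub>R axis i 1" and x = 0])
      (use assms in \<open>auto intro!: derivative_eq_intros\<close>)
  then have "((\<lambda>s. f (x + s *\<^sub>R axis i 1)) has_real_derivative D (axis i 1)) (at 0)"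
    by (simp add: has_field_derivative_def linear_cmul[OF lin] mult.commute[of _ "D _"])
  then show ?thesis unfolding partial_def by (rule DERIV_imp_deriv)
qed

lemma partial_vel_eq_derivative:
  assumes "(l has_derivative D) (at (q, v))"
  shows "partial_vel i l (q, v) = D (0, axis i 1)"
proof -
  have "((\<lambda>v'. l (q, v')) has_derivative (\<lambda>h. D (0, h))) (at v)"
    by (rule has_derivative_compose[where g = l and f = "\<lambda>v'. (q, v')"])
      (use assms in \<open>auto intro!: derivative_eq_intros\<close>)
  from partial_eq_derivative[OF this] show ?thesis by (simp add: partial_vel_def)
qed

lemma partial_pos_eq_derivative:
  assumes "(l has_derivative D) (at (q, v))"
  shows "partial_pos i l (q, v) = D (axis i 1, 0)"
proof -
  have "((\<lambda>q'. l (q', v)) has_derivative (\<lambda>h. D (h, 0))) (at q)"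
    by (rule has_derivative_compose[where g = l and f = "\<lambda>q'. (q', v)"])
      (use assms in \<open>auto intro!: derivative_eq_intros\<close>)
  from partial_eq_derivative[OF this] show ?thesis by (simp add: partial_pos_def)
qed

lemma linear_sum_axis:
  fixes D :: "real^'d::finite \<Rightarrow> 'b::real_vector"
  assumes "linear D"
  shows "D w = (\<Sum>i\<in>UNIV. w $ i *\<^sub>R D (axis i 1))"
proof -
  have "D w = D (\<Sum>i\<in>UNIV. w $ i *\<^sub>R axis i 1)"
    by (simp add: basis_expansion flip: scalar_mult_eq_scaleR)
  then show ?thesis by (simp add: linear_sum[OF assms] linear_cmul[OF assms])
qed

lemma derivative_eq_partials:
  fixes l :: "(real^'d::finite) \<times> (real^'d) \<Rightarrow> real"
  assumes "(l has_derivative D) (at (q, v))"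
  shows "D (h, k) = (\<Sum>i\<in>UNIV. partial_pos i l (q, v) * h $ i) + (\<Sum>i\<in>UNIV. partial_vel i l (q, v) * k $ i)"
proof -
  have lin: "linear D" using assms by (rule has_derivative_linear)
  have "linear (\<lambda>h. D (h, 0))" "linear (\<lambda>k. D (0, k))"
    by (auto intro!: linear_compose[unfolded o_def, OF _ lin] linearI)
  from linear_sum_axis[OF this(1), of h] linear_sum_axis[OF this(2), of k]
  have "D (h, 0) + D (0, k) = (\<Sum>i\<in>UNIV. h $ i * D (axis i 1, 0)) + (\<Sum>i\<in>UNIV. k $ i * D (0, axis i 1))"
    by simp
  moreover have "D (h, k) = D (h, 0) + D (0, k)"
    using linear_add[OF lin, of "(h, 0)" "(0, k)"] by simp
  ultimately show ?thesis
    by (simp add: partial_pos_eq_derivative[OF assms] partial_vel_eq_derivative[OF assms] mult.commute)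
qed

text \<open>The Euler--Lagrange expression for a curve that is already given in coordinates. It allows the
  transformation law to be proved for functions on Euclidean space, with no manifold in sight.\<close>

definition coordinate_euler_lagrange ::
  "((real^'d::finite) \<times> (real^'d) \<Rightarrow> real) \<Rightarrow> real set \<Rightarrow> (real \<Rightarrow> real^'d) \<Rightarrow> real \<Rightarrow> 'd \<Rightarrow> real"
  where "coordinate_euler_lagrange l I u t i =
    vector_derivative (\<lambda>s. partial_vel i l (u s, vector_derivative u (at s within I))) (at t within I)
    - partial_pos i l (u t, vector_derivative u (at t within I))"

lemma euler_lagrange_eq_coordinate:
  "euler_lagrange A L c I x t i = coordinate_euler_lagrange (lagrangian_in A L c) I (coords c \<circ> x) t i"
  by (simp add: euler_lagrange_def coordinate_euler_lagrange_def lifted_curve_def)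

lemma has_vector_derivative_transform_openin:
  assumes "openin (top_of_set I) J" "t \<in> J" "\<And>s. s \<in> J \<Longrightarrow> f s = g s"
    and "(f has_vector_derivative f') (at t within I)"
  shows "(g has_vector_derivative f') (at t within I)"
proof -
  obtain T where T: "open T" "J = I \<inter> T" using assms(1) by (auto simp: openin_open)
  have "eventually (\<lambda>s. s \<in> T) (nhds t)" using T assms(2) by (intro eventually_nhds_in_open) auto
  then have "eventually (\<lambda>s. s \<in> I \<longrightarrow> f s = g s) (nhds t)"
    by eventually_elim (use assms(3) T in auto)
  from has_vector_derivative_cong_ev[OF this] assms show ?thesis by blast
qed

lemma has_vector_derivative_compose_has_derivative:
  assumes "(u has_vector_derivative u') (at t within I)" "(f has_derivative D) (at (u t))"
  shows "((\<lambda>s. f (u s)) has_vector_derivative D u') (at t within I)"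
proof -
  have "((\<lambda>s. f (u s)) has_derivative (\<lambda>s. D (s *\<^sub>R u'))) (at t within I)"
    by (rule has_derivative_compose[OF assms(1)[unfolded has_vector_derivative_def] assms(2)])
  moreover have "linear D" using assms(2) by (rule has_derivative_linear)
  ultimately show ?thesis by (simp add: has_vector_derivative_def linear_cmul)
qed

text \<open>With the base point fixed the relation between the two Lagrangians is linear in the velocity, so
  that fibre derivatives are pulled back by \<open>G\<close>, which stands for the derivative of \<open>F\<close> at \<open>y\<close>.\<close>

lemma partial_vel_related:
  fixes F :: "real^'n::finite \<Rightarrow> real^'m::finite"
  assumes l': "(l' has_derivative D') (at (F y, G v))" and G: "bounded_linear G"
    and rel: "\<And>v. l (y, v) = l' (F y, G v)"
  shows "partial_vel a l (y, v) = (\<Sum>i\<in>UNIV. partial_vel i l' (F y, G v) * G (axis a 1) $ i)"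
proof -
  have "((\<lambda>v. l' (F y, G v)) has_derivative (\<lambda>h. D' (0, G h))) (at v)"
    by (rule has_derivative_compose[where g = l' and f = "\<lambda>v. (F y, G v)"])
      (use assms in \<open>auto intro!: derivative_eq_intros bounded_linear.has_derivative[OF G]\<close>)
  then have "partial a (\<lambda>v. l (y, v)) v = D' (0, G (axis a 1))"
    unfolding rel by (rule partial_eq_derivative)
  then show ?thesis by (simp add: partial_vel_def derivative_eq_partials[OF l'])
qed

text \<open>Here \<open>g x\<close> stands for \<open>DF x v\<close> with \<open>v\<close> fixed. Moving the base point also moves the image
  velocity, hence the second sum; it is the term in which the second derivative of \<open>F\<close> enters.\<close>

lemma partial_pos_related:
  fixes F :: "real^'n::finite \<Rightarrow> real^'m::finite"
  assumes l': "(l' has_derivative D') (at (F y, g y))"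
    and F: "(F has_derivative F') (at y)" and g: "(g has_derivative g') (at y)"
    and S: "open S" "y \<in> S" and rel: "\<And>x. x \<in> S \<Longrightarrow> l (x, v) = l' (F x, g x)"
  shows "partial_pos a l (y, v) = (\<Sum>i\<in>UNIV. partial_pos i l' (F y, g y) * F' (axis a 1) $ i)
      + (\<Sum>i\<in>UNIV. partial_vel i l' (F y, g y) * g' (axis a 1) $ i)"
proof -
  have "((\<lambda>x. l' (F x, g x)) has_derivative (\<lambda>h. D' (F' h, g' h))) (at y)"
    by (rule has_derivative_compose[where g = l' and f = "\<lambda>x. (F x, g x)"])
      (use assms in \<open>auto intro!: derivative_eq_intros\<close>)
  then have "((\<lambda>x. l (x, v)) has_derivative (\<lambda>h. D' (F' h, g' h))) (at y)"
    using S rel by (auto intro: has_derivative_transform_within_open)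
  then have "partial a (\<lambda>x. l (x, v)) y = D' (F' (axis a 1), g' (axis a 1))"
    by (rule partial_eq_derivative)
  then show ?thesis by (simp add: partial_pos_def derivative_eq_partials[OF l'])
qed

text \<open>The Euler--Lagrange expression is a covector along the curve. With the momenta
  \<open>p\<^sub>i = \<partial>l'/\<partial>v\<^sup>i\<close>, the product rule applied to \<open>\<partial>l/\<partial>v\<^sup>a = p\<^sub>i (DF e\<^sub>a)\<^sup>i\<close> yields the extra term
  \<open>p\<^sub>i (D(DF e\<^sub>a) u')\<^sup>i\<close>, while \<open>\<partial>l/\<partial>y\<^sup>a\<close> contains \<open>p\<^sub>i (D(DF u') e\<^sub>a)\<^sup>i\<close>. The two cancel by the symmetry
  of second derivatives.

  The map \<open>F\<close> is an arbitrary smooth one, so that the lemma applies to the inclusion of a submanifold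
  as well as to chart transitions.\<close>

lemma coordinate_euler_lagrange_related:
  fixes F :: "real^'n::finite \<Rightarrow> real^'m::finite"
  assumes W: "open W" and F: "smooth_on W F"
    and FW: "F ` W \<subseteq> U'" and l': "smooth_on (U' \<times> UNIV) l'"
    and rel: "\<And>y v. y \<in> W \<Longrightarrow> l (y, v) = l' (F y, frechet_derivative F (at y) v)"
    and I: "\<And>s. s \<in> I \<Longrightarrow> at s within I \<noteq> bot"
    and J: "openin (top_of_set I) J" "t \<in> J"
    and uW: "\<And>s. s \<in> J \<Longrightarrow> u s \<in> W" and z: "\<And>s. s \<in> J \<Longrightarrow> z s = F (u s)"
    and u': "\<And>s. s \<in> J \<Longrightarrow> (u has_vector_derivative u' s) (at s within I)"
    and u'': "(u' has_vector_derivative u'') (at t within I)"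
  shows "coordinate_euler_lagrange l I u t a =
    (\<Sum>i\<in>UNIV. coordinate_euler_lagrange l' I z t i * frechet_derivative F (at (u t)) (axis a 1) $ i)"
proof -
  define DF where "DF y = frechet_derivative F (at y)" for y
  have DF: "(F has_derivative DF y) (at y)" if "y \<in> W" for y
    unfolding DF_def by (rule smooth_on_has_derivative[OF F that])
  define DDF where "DDF y h = frechet_derivative (\<lambda>y. DF y h) (at y)" for y h
  have DDF: "((\<lambda>y. DF y h) has_derivative DDF y h) (at y)" if "y \<in> W" for y h
    unfolding DF_def DDF_def
    by (rule smooth_on_has_derivative[OF smooth_on_frechet_derivative[OF F] that])
  have sym: "DDF y h k = DDF y k h" if "y \<in> W" for y h k
    unfolding DF_def DDF_def by (rule smooth_on_symmetric_second_derivative[OF W that F])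
  define Dl' where "Dl' w = frechet_derivative l' (at w)" for w
  have Dl': "(l' has_derivative Dl' (F y, v)) (at (F y, v))" if "y \<in> W" for y v
    unfolding Dl'_def by (rule smooth_on_has_derivative[OF l']) (use FW that in auto)
  have J_I: "s \<in> I" if "s \<in> J" for s using J(1) that by (auto dest: openin_imp_subset)
  have vu: "vector_derivative u (at s within I) = u' s" if "s \<in> J" for s
    by (rule vector_derivative_within[OF I[OF J_I[OF that]] u'[OF that]])
  define z1 where "z1 s = DF (u s) (u' s)" for s
  have Fu: "((\<lambda>s. F (u s)) has_vector_derivative z1 s) (at s within I)" if "s \<in> J" for s
    unfolding z1_def by (rule has_vector_derivative_compose_has_derivative[OF u'[OF that] DF[OF uW[OF that]]])
  have z': "(z has_vector_derivative z1 s) (at s within I)" if "s \<in> J" for s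
    by (rule has_vector_derivative_transform_openin[OF J(1) that z[symmetric] Fu[OF that]])
  have vz: "vector_derivative z (at s within I) = z1 s" if "s \<in> J" for s
    by (rule vector_derivative_within[OF I[OF J_I[OF that]] z'[OF that]])
  have DFu: "((\<lambda>s. DF (u s) h) has_vector_derivative DDF (u t) h (u' t)) (at t within I)" for h
    by (rule has_vector_derivative_compose_has_derivative[OF u'[OF J(2)] DDF[OF uW[OF J(2)]]])
  have "((\<lambda>s. \<Sum>b\<in>UNIV. u' s $ b *\<^sub>R DF (u s) (axis b 1)) has_vector_derivative
      (\<Sum>b\<in>UNIV. u' t $ b *\<^sub>R DDF (u t) (axis b 1) (u' t) + u'' $ b *\<^sub>R DF (u t) (axis b 1))) (at t within I)"
    by (intro has_vector_derivative_sum has_vector_derivative_scaleR DFu)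
      (use bounded_linear.has_vector_derivative[OF bounded_linear_vec_nth u'']
        in \<open>simp add: has_real_derivative_iff_has_vector_derivative\<close>)
  then obtain z2 where "((\<lambda>s. \<Sum>b\<in>UNIV. u' s $ b *\<^sub>R DF (u s) (axis b 1)) has_vector_derivative z2) (at t within I)"
    by blast
  then have z2: "(z1 has_vector_derivative z2) (at t within I)"
    by (rule has_vector_derivative_transform_openin[OF J, rotated])
      (simp only: z1_def linear_sum_axis[OF has_derivative_linear[OF DF[OF uW]], of _ "u' _"])
  have lift: "((\<lambda>s. (F (u s), z1 s)) has_vector_derivative (z1 t, z2)) (at t within I)"
    by (rule has_vector_derivative_Pair[OF Fu[OF J(2)] z2])
  \<comment> \<open>the momenta of \<open>l'\<close> along the image curve\<close>
  define p where "p i s = partial_vel i l' (z s, vector_derivative z (at s within I))" for i s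
  have p_eq: "p i s = Dl' (F (u s), z1 s) (0, axis i 1)" if "s \<in> J" for i s
    using that by (simp add: p_def vz z partial_vel_eq_derivative[OF Dl'[OF uW]])
  define p' where "p' i = vector_derivative (p i) (at t within I)" for i
  have p': "(p i has_vector_derivative p' i) (at t within I)" for i
  proof -
    have "((\<lambda>w. Dl' w (0, axis i 1)) has_derivative frechet_derivative (\<lambda>w. Dl' w (0, axis i 1)) (at (F (u t), z1 t)))
        (at (F (u t), z1 t))"
      unfolding Dl'_def
      by (rule smooth_on_has_derivative[OF smooth_on_frechet_derivative[OF l']]) (use FW uW J in auto)
    from has_vector_derivative_compose_has_derivative[OF lift this] obtain r
      where "((\<lambda>s. Dl' (F (u s), z1 s) (0, axis i 1)) has_vector_derivative r) (at t within I)" by blast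
    then have "(p i has_vector_derivative r) (at t within I)"
      by (rule has_vector_derivative_transform_openin[OF J, rotated]) (simp add: p_eq)
    with vector_derivative_within[OF I[OF J_I[OF J(2)]] this] show ?thesis
      by (simp only: p'_def)
  qed
  have P: "partial_vel a l (u s, vector_derivative u (at s within I)) = (\<Sum>i\<in>UNIV. p i s * DF (u s) (axis a 1) $ i)"
    if "s \<in> J" for s
    using partial_vel_related[where F = F and l' = l' and l = l and a = a and y = "u s" and v = "u' s" and G = "DF (u s)",
        OF Dl'[OF uW[OF that]] has_derivative_bounded_linear[OF DF[OF uW[OF that]]] rel[OF uW[OF that], folded DF_def]]
    by (simp only: vu[OF that] p_def vz[OF that] z[OF that] z1_def)
  have "((\<lambda>s. \<Sum>i\<in>UNIV. p i s * DF (u s) (axis a 1) $ i) has_vector_derivative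
      (\<Sum>i\<in>UNIV. p i t * DDF (u t) (axis a 1) (u' t) $ i + p' i * DF (u t) (axis a 1) $ i)) (at t within I)"
    by (intro has_vector_derivative_sum has_vector_derivative_mult p'
        bounded_linear.has_vector_derivative[OF bounded_linear_vec_nth DFu])
  then have "((\<lambda>s. partial_vel a l (u s, vector_derivative u (at s within I))) has_vector_derivative
      (\<Sum>i\<in>UNIV. p i t * DDF (u t) (axis a 1) (u' t) $ i + p' i * DF (u t) (axis a 1) $ i)) (at t within I)"
    by (rule has_vector_derivative_transform_openin[OF J, rotated]) (simp add: P)
  then have 1: "vector_derivative (\<lambda>s. partial_vel a l (u s, vector_derivative u (at s within I))) (at t within I)
      = (\<Sum>i\<in>UNIV. p i t * DDF (u t) (axis a 1) (u' t) $ i + p' i * DF (u t) (axis a 1) $ i)"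
    by (rule vector_derivative_within[OF I[OF J_I[OF J(2)]]])
  have 2: "partial_pos a l (u t, u' t) = (\<Sum>i\<in>UNIV. partial_pos i l' (z t, z1 t) * DF (u t) (axis a 1) $ i)
      + (\<Sum>i\<in>UNIV. p i t * DDF (u t) (axis a 1) (u' t) $ i)"
    using partial_pos_related[where F = F and l' = l' and g = "\<lambda>y. DF y (u' t)" and l = l and v = "u' t" and a = a,
        OF Dl'[OF uW[OF J(2)]] DF[OF uW[OF J(2)]] DDF[OF uW[OF J(2)]] W uW[OF J(2)] rel[folded DF_def]]
    by (simp only: z[OF J(2)] z1_def p_def vz[OF J(2)] sym[OF uW[OF J(2)], of "u' t"])
  show ?thesis
    unfolding coordinate_euler_lagrange_def 1
    unfolding vu[OF J(2)] 2 vz[OF J(2)] DF_def[symmetric]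
    by (simp add: p'_def p_def[abs_def] left_diff_distrib sum.distrib sum_subtractf)
qed

section \<open>Paths of class \<open>C\<^sup>k\<close>\<close>

text \<open>Counting derivatives makes induction on the order of differentiability possible, which a single
  infinite sequence of derivatives does not.\<close>

primrec C_path :: "nat \<Rightarrow> real set \<Rightarrow> (real \<Rightarrow> 'a::real_normed_vector) \<Rightarrow> bool" where
  "C_path 0 J f \<longleftrightarrow> continuous_on J f"
| "C_path (Suc k) J f \<longleftrightarrow>
     (\<exists>f'. (\<forall>t\<in>J. (f has_vector_derivative f' t) (at t within J)) \<and> C_path k J f')"

lemma C_path_SucI:
  assumes "\<And>t. t \<in> J \<Longrightarrow> (f has_vector_derivative f' t) (at t within J)" "C_path k J f'"
  shows "C_path (Suc k) J f"
  using assms by auto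

lemma C_path_cong:
  assumes "C_path k J f" "\<And>t. t \<in> J \<Longrightarrow> f t = g t"
  shows "C_path k J g"
proof (cases k)
  case 0
  with assms show ?thesis by (simp cong: continuous_on_cong)
next
  case (Suc n)
  with assms(1) obtain f' where f': "\<And>t. t \<in> J \<Longrightarrow> (f has_vector_derivative f' t) (at t within J)"
    "C_path n J f'" by auto
  have "(g has_vector_derivative f' t) (at t within J)" if "t \<in> J" for t
    using has_vector_derivative_transform[OF that _ f'(1)[OF that]] assms(2) by simp
  with f'(2) Suc show ?thesis by auto
qed

lemma C_path_Suc_imp: "C_path (Suc k) J f \<Longrightarrow> C_path k J f"
proof (induction k arbitrary: f)
  case 0
  then obtain f' where "\<And>t. t \<in> J \<Longrightarrow> (f has_vector_derivative f' t) (at t within J)" by auto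
  then show ?case
    by (auto simp: continuous_on_eq_continuous_within intro: has_vector_derivative_continuous)
next
  case (Suc k)
  from Suc.prems obtain f' where "\<And>t. t \<in> J \<Longrightarrow> (f has_vector_derivative f' t) (at t within J)"
    "C_path (Suc k) J f'" by auto
  with Suc.IH[of f'] show ?case by auto
qed

lemma C_path_const: "C_path k J (\<lambda>t. c)"
  by (induction k arbitrary: c) (auto intro!: exI[of _ "\<lambda>_. 0"])

lemma C_path_add: "C_path k J f \<Longrightarrow> C_path k J g \<Longrightarrow> C_path k J (\<lambda>t. f t + g t)"
proof (induction k arbitrary: f g)
  case 0
  then show ?case by (auto intro: continuous_on_add)
next
  case (Suc k)
  from Suc.prems obtain f' g' where d:
    "\<And>t. t \<in> J \<Longrightarrow> (f has_vector_derivative f' t) (at t within J)" "C_path k J f'"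
    "\<And>t. t \<in> J \<Longrightarrow> (g has_vector_derivative g' t) (at t within J)" "C_path k J g'"
    by auto
  show ?case
    by (rule C_path_SucI[OF has_vector_derivative_add[OF d(1,3)] Suc.IH[OF d(2,4)]])
qed

lemma C_path_sum:
  assumes "\<And>i. i \<in> A \<Longrightarrow> C_path k J (f i)"
  shows "C_path k J (\<lambda>t. \<Sum>i\<in>A. f i t)"
  using assms by (induction A rule: infinite_finite_induct) (auto intro: C_path_const C_path_add)

lemma C_path_bilinear:
  assumes "bounded_bilinear p"
  shows "C_path k J f \<Longrightarrow> C_path k J g \<Longrightarrow> C_path k J (\<lambda>t. p (f t) (g t))"
proof (induction k arbitrary: f g)
  case 0
  then show ?case by (auto intro: bounded_bilinear.continuous_on[OF assms])
next
  case (Suc k)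
  from Suc.prems obtain f' g' where d:
    "\<And>t. t \<in> J \<Longrightarrow> (f has_vector_derivative f' t) (at t within J)" "C_path k J f'"
    "\<And>t. t \<in> J \<Longrightarrow> (g has_vector_derivative g' t) (at t within J)" "C_path k J g'"
    by auto
  have "((\<lambda>t. p (f t) (g t)) has_vector_derivative p (f t) (g' t) + p (f' t) (g t)) (at t within J)"
    if "t \<in> J" for t
    by (rule bounded_bilinear.has_vector_derivative[OF assms d(1,3)[OF that]])
  moreover have "C_path k J (\<lambda>t. p (f t) (g' t) + p (f' t) (g t))"
    using Suc.prems d by (intro C_path_add Suc.IH) (auto intro: C_path_Suc_imp simp del: C_path.simps)
  ultimately show ?case by (rule C_path_SucI)
qed

lemmas C_path_mult = C_path_bilinear[OF bounded_bilinear_mult]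
lemmas C_path_scaleR = C_path_bilinear[OF bounded_bilinear_scaleR]
lemmas C_path_inner = C_path_bilinear[OF bounded_bilinear_inner]

lemma C_path_prod:
  fixes f :: "'i \<Rightarrow> real \<Rightarrow> real"
  assumes "\<And>i. i \<in> A \<Longrightarrow> C_path k J (f i)"
  shows "C_path k J (\<lambda>t. \<Prod>i\<in>A. f i t)"
  using assms by (induction A rule: infinite_finite_induct) (auto intro: C_path_const C_path_mult)

lemma C_path_inverse:
  fixes f :: "real \<Rightarrow> real"
  assumes "\<And>t. t \<in> J \<Longrightarrow> f t \<noteq> 0"
  shows "C_path k J f \<Longrightarrow> C_path k J (\<lambda>t. inverse (f t))"
proof (induction k)
  case 0
  with assms show ?case by (auto intro: continuous_on_inverse)
next
  case (Suc k)
  from Suc.prems obtain f' where f':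
    "\<And>t. t \<in> J \<Longrightarrow> (f has_vector_derivative f' t) (at t within J)" "C_path k J f'"
    by auto
  have "((\<lambda>t. inverse (f t)) has_vector_derivative - 1 * (inverse (f t) * f' t * inverse (f t))) (at t within J)"
    if "t \<in> J" for t
    using DERIV_inverse'[of f "f' t" t J] f'(1)[OF that] assms[OF that]
    by (simp add: has_real_derivative_iff_has_vector_derivative)
  moreover have "C_path k J (\<lambda>t. - 1 * (inverse (f t) * f' t * inverse (f t)))"
    using Suc.IH[OF C_path_Suc_imp[OF Suc.prems]] f'(2) by (intro C_path_mult C_path_const)
  ultimately show ?case by (rule C_path_SucI)
qed

lemma C_path_vec_nth:
  fixes f :: "real \<Rightarrow> real^'d::finite"
  assumes "C_path k J f"
  shows "C_path k J (\<lambda>t. f t $ i)"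
  using C_path_inner[OF assms C_path_const[of k J "axis i 1"]] by (simp add: inner_axis)

lemma C_path_vec:
  fixes f :: "real \<Rightarrow> real^'d::finite"
  assumes "\<And>i. C_path k J (\<lambda>t. f t $ i)"
  shows "C_path k J f"
proof -
  have "C_path k J (\<lambda>t. \<Sum>i\<in>UNIV. f t $ i *\<^sub>R axis i 1)"
    by (intro C_path_sum C_path_scaleR assms C_path_const)
  then show ?thesis
    by (rule C_path_cong) (simp add: basis_expansion flip: scalar_mult_eq_scaleR)
qed

lemma C_path_det:
  fixes A :: "real \<Rightarrow> real^'d^'d::finite"
  assumes "\<And>i j. C_path k J (\<lambda>t. A t $ i $ j)"
  shows "C_path k J (\<lambda>t. det (A t))"
  unfolding det_def by (intro C_path_sum C_path_mult C_path_prod C_path_const assms)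

text \<open>Cramer's rule expresses the solution of a linear system rationally by its data.\<close>

lemma C_path_cramer:
  fixes A :: "real \<Rightarrow> real^'d^'d::finite"
  assumes "\<And>i j. C_path k J (\<lambda>t. A t $ i $ j)" "\<And>i. C_path k J (\<lambda>t. b t $ i)"
    and "\<And>t. t \<in> J \<Longrightarrow> det (A t) \<noteq> 0" "\<And>t. t \<in> J \<Longrightarrow> A t *v x t = b t"
  shows "C_path k J x"
proof (rule C_path_vec)
  fix c
  have "C_path k J (\<lambda>t. if j = c then b t $ i else A t $ i $ j)" for i j
    using assms(1,2) by (cases "j = c") auto
  then have "C_path k J (\<lambda>t. det (\<chi> i j. if j = c then b t $ i else A t $ i $ j) * inverse (det (A t)))"
    by (intro C_path_mult C_path_inverse C_path_det assms) auto
  then show "C_path k J (\<lambda>t. x t $ c)"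
  proof (rule C_path_cong)
    fix t assume "t \<in> J"
    show "det (\<chi> i j. if j = c then b t $ i else A t $ i $ j) * inverse (det (A t)) = x t $ c"
      using assms(4)[OF \<open>t \<in> J\<close>] unfolding cramer[OF assms(3)[OF \<open>t \<in> J\<close>]]
      by (simp add: divide_inverse)
  qed
qed

lemma C_path_smooth_compose:
  fixes u :: "real \<Rightarrow> real^'d::finite"
  assumes "u ` J \<subseteq> W"
  shows "smooth_on W g \<Longrightarrow> C_path k J u \<Longrightarrow> C_path k J (\<lambda>t. g (u t))"
proof (induction k arbitrary: g)
  case 0
  then show ?case using assms by (auto intro: continuous_on_compose2[OF smooth_on_imp_continuous_on])
next
  case (Suc k)
  from Suc.prems obtain u' where u':
    "\<And>t. t \<in> J \<Longrightarrow> (u has_vector_derivative u' t) (at t within J)" "C_path k J u'"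
    by auto
  have "((\<lambda>t. g (u t)) has_vector_derivative
      (\<Sum>b\<in>UNIV. u' t $ b *\<^sub>R frechet_derivative g (at (u t)) (axis b 1))) (at t within J)"
    if "t \<in> J" for t
  proof -
    have g': "(g has_derivative frechet_derivative g (at (u t))) (at (u t))"
      using assms that by (intro smooth_on_has_derivative[OF Suc.prems(1)]) auto
    show ?thesis
      using has_vector_derivative_compose_has_derivative[OF u'(1)[OF that] g']
      by (subst linear_sum_axis[OF has_derivative_linear[OF g'], symmetric])
  qed
  moreover have "C_path k J (\<lambda>t. \<Sum>b\<in>UNIV. u' t $ b *\<^sub>R frechet_derivative g (at (u t)) (axis b 1))"
    using C_path_Suc_imp[OF Suc.prems(2)] u'(2)
    by (intro C_path_sum C_path_scaleR C_path_vec_nth Suc.IH smooth_on_frechet_derivative Suc.prems)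
  ultimately show ?case by (rule C_path_SucI)
qed

lemma at_within_openin:
  assumes "openin (top_of_set J) J'" "t \<in> J'"
  shows "at t within J' = at t within J"
proof -
  obtain T where "open T" "J' = J \<inter> T" using assms(1) by (auto simp: openin_open)
  with assms(2) show ?thesis by (intro at_within_nhd[of t T]) auto
qed

lemma smooth_path_on_subset:
  assumes "smooth_path_on J f" "J' \<subseteq> J"
  shows "smooth_path_on J' f"
proof -
  obtain D where D: "\<And>t. t \<in> J \<Longrightarrow> D 0 t = f t"
    "\<And>k t. t \<in> J \<Longrightarrow> (D k has_vector_derivative D (Suc k) t) (at t within J)"
    using assms(1) unfolding smooth_path_on_def by blast
  have "(D k has_vector_derivative D (Suc k) t) (at t within J')" if "t \<in> J'" for k t
    using that assms(2) by (intro has_vector_derivative_within_subset[OF D(2)]) auto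
  with D(1) assms(2) show ?thesis
    unfolding smooth_path_on_def by (intro exI[of _ D]) auto
qed

lemma smooth_path_on_imp_C_path:
  assumes "smooth_path_on J f"
  shows "C_path k J f"
proof -
  obtain D where D: "\<And>t. t \<in> J \<Longrightarrow> D 0 t = f t"
    "\<And>k t. t \<in> J \<Longrightarrow> (D k has_vector_derivative D (Suc k) t) (at t within J)"
    using assms unfolding smooth_path_on_def by blast
  have "C_path k J (D j)" for j
  proof (induction k arbitrary: j)
    case 0
    show ?case
      using D(2)[of _ j]
      by (auto simp: continuous_on_eq_continuous_within intro: has_vector_derivative_continuous)
  next
    case (Suc k)
    then show ?case using D(2)[of _ j] by auto
  qed
  from C_path_cong[OF this D(1)] show ?thesis .
qed

text \<open>Where \<open>J\<close> has no isolated points, the derivative in the definition of \<open>C_path\<close> is unique. This is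
  what allows derivatives of different orders, and derivatives found locally, to be fitted together.\<close>

lemma C_path_Suc_vector_derivative:
  assumes "C_path (Suc k) J f" and J: "\<And>t. t \<in> J \<Longrightarrow> at t within J \<noteq> bot"
  shows "t \<in> J \<Longrightarrow> (f has_vector_derivative vector_derivative f (at t within J)) (at t within J)"
    and "C_path k J (\<lambda>t. vector_derivative f (at t within J))"
proof -
  obtain f' where f': "\<And>t. t \<in> J \<Longrightarrow> (f has_vector_derivative f' t) (at t within J)" "C_path k J f'"
    using assms(1) by auto
  have eq: "vector_derivative f (at t within J) = f' t" if "t \<in> J" for t
    by (rule vector_derivative_within[OF J f'(1)]) fact+
  show "t \<in> J \<Longrightarrow> (f has_vector_derivative vector_derivative f (at t within J)) (at t within J)"
    using f'(1) eq by simp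
  show "C_path k J (\<lambda>t. vector_derivative f (at t within J))"
    by (rule C_path_cong[OF f'(2)]) (simp add: eq)
qed

text \<open>The derivatives provided for the various \<open>k\<close> are unrelated a priori; the iterated
  \<open>vector_derivative\<close> is a choice that works for all \<open>k\<close> at once.\<close>

lemma C_path_imp_smooth_path_on:
  assumes f: "\<And>k. C_path k J f" and J: "\<And>t. t \<in> J \<Longrightarrow> at t within J \<noteq> bot"
  shows "smooth_path_on J f"
proof -
  define D where "D j = ((\<lambda>g t. vector_derivative g (at t within J)) ^^ j) f" for j
  have D: "C_path k J (D j)" for j k
  proof (induction j arbitrary: k)
    case 0
    then show ?case using f by (simp add: D_def)
  next
    case (Suc j)
    from C_path_Suc_vector_derivative(2)[OF Suc.IH[of "Suc k"] J] show ?case by (simp add: D_def)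
  qed
  have "(D j has_vector_derivative D (Suc j) t) (at t within J)" if "t \<in> J" for j t
    using C_path_Suc_vector_derivative(1)[OF D[of "Suc 0" j] J that] by (simp add: D_def)
  then show ?thesis
    unfolding smooth_path_on_def by (intro exI[of _ D]) (auto simp: D_def)
qed

lemma C_path_local:
  assumes "\<And>t. t \<in> J \<Longrightarrow> \<exists>J'. openin (top_of_set J) J' \<and> t \<in> J' \<and> C_path k J' f"
    and J: "\<And>t. t \<in> J \<Longrightarrow> at t within J \<noteq> bot"
  shows "C_path k J f"
  using assms(1)
proof (induction k arbitrary: f)
  case 0
  show ?case unfolding C_path.simps continuous_on_eq_continuous_within
  proof
    fix t assume "t \<in> J"
    with 0 obtain J' where J': "openin (top_of_set J) J'" "t \<in> J'" "continuous_on J' f" by auto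
    then have "continuous (at t within J') f" by (simp add: continuous_on_eq_continuous_within)
    then show "continuous (at t within J) f" using at_within_openin[OF J'(1,2)] by simp
  qed
next
  case (Suc k)
  have loc: "\<exists>J'. openin (top_of_set J) J' \<and> t \<in> J' \<and>
      (f has_vector_derivative vector_derivative f (at t within J)) (at t within J) \<and>
      C_path k J' (\<lambda>t. vector_derivative f (at t within J))" if "t \<in> J" for t
  proof -
    obtain J' where J': "openin (top_of_set J) J'" "t \<in> J'" "C_path (Suc k) J' f"
      using Suc.prems \<open>t \<in> J\<close> by blast
    have within: "at s within J' = at s within J" "at s within J \<noteq> bot" if "s \<in> J'" for s
      using at_within_openin[OF J'(1) that] J openin_imp_subset[OF J'(1)] that by auto
    then have bot: "at s within J' \<noteq> bot" if "s \<in> J'" for s using that by simp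
    have "C_path k J' (\<lambda>t. vector_derivative f (at t within J))"
      by (rule C_path_cong[OF C_path_Suc_vector_derivative(2)[OF J'(3) bot]]) (simp_all add: within)
    with J' C_path_Suc_vector_derivative(1)[OF J'(3) bot J'(2)] show ?thesis
      by (auto simp: within)
  qed
  show ?case
  proof (rule C_path_SucI)
    show "(f has_vector_derivative vector_derivative f (at t within J)) (at t within J)" if "t \<in> J" for t
      using loc[OF that] by blast
    show "C_path k J (\<lambda>t. vector_derivative f (at t within J))"
      using loc by (intro Suc.IH) blast
  qed
qed

section \<open>Immersions reflect smoothness of paths\<close>

text \<open>Let \<open>P\<close> be a left inverse of \<open>A\<close>. The increments satisfy
  \<open>\<Delta>u = P (\<Delta>(F \<circ> u)) - P r\<close> with \<open>r = o(\<Delta>u)\<close>, because \<open>u\<close> is continuous. Absorbing the remainder into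
  the left-hand side shows \<open>\<Delta>u = O(s - t)\<close>; then \<open>r = o(s - t)\<close>, and \<open>P z'\<close> is the derivative.\<close>

lemma immersion_reflects_differentiability:
  fixes F :: "'a::euclidean_space \<Rightarrow> 'b::euclidean_space"
  assumes F: "(F has_derivative A) (at (u t))" and "inj A"
    and u: "continuous (at t within J) u"
    and z: "((\<lambda>s. F (u s)) has_vector_derivative z') (at t within J)"
  shows "\<exists>u'. (u has_vector_derivative u') (at t within J)"
proof -
  have linA: "linear A" using F by (rule has_derivative_linear)
  obtain P where P: "linear P" "P \<circ> A = id"
    using linear_injective_left_inverse[OF linA \<open>inj A\<close>] by blast
  have PA: "P (A x) = x" for x using P(2) by (simp add: fun_eq_iff)
  have bP: "bounded_linear P" using P(1) by (simp add: linear_conv_bounded_linear)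
  obtain K where K: "K > 0" "\<And>x. norm (P x) \<le> norm x * K"
    using bounded_linear.pos_bounded[OF bP] by blast
  define M where "M = norm z' + 1"
  have "M > 0" by (simp add: M_def add_nonneg_pos)
  have zder: "eventually (\<lambda>s. norm (F (u s) - F (u t) - (s - t) *\<^sub>R z') \<le> e * norm (s - t)) (at t within J)"
    if "e > 0" for e
    using z that unfolding has_vector_derivative_def has_derivative_within_alt2 by blast
  have Fder: "eventually (\<lambda>s. norm (F (u s) - F (u t) - A (u s - u t)) \<le> e * norm (u s - u t)) (at t within J)"
    if "e > 0" for e
  proof -
    have "eventually (\<lambda>y. norm (F y - F (u t) - A (y - u t)) \<le> e * norm (y - u t)) (at (u t))"
      using F that unfolding has_derivative_within_alt2 by blast
    then have "eventually (\<lambda>y. norm (F y - F (u t) - A (y - u t)) \<le> e * norm (y - u t)) (nhds (u t))"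
      by (rule eventually_nhds_conv_at[THEN iffD2, OF conjI]) (simp add: linear_0[OF linA])
    moreover have "(u \<longlongrightarrow> u t) (at t within J)" using u by (simp add: continuous_within)
    ultimately show ?thesis unfolding filterlim_iff by blast
  qed
  have "eventually (\<lambda>s. norm (u s - u t - (s - t) *\<^sub>R P z') \<le> e * norm (s - t)) (at t within J)"
    if "e > 0" for e
  proof -
    \<comment> \<open>The first bound absorbs half of \<open>\<Delta>u\<close>, so that the norm of \<open>\<Delta>u\<close> is at most \<open>2 K M \<bar>s - t\<bar>\<close>; with
      the second bound, the norm of \<open>P r\<close> is then at most \<open>e / 2 * \<bar>s - t\<bar>\<close>.\<close>
    define c where "c = min (1 / (2 * K)) (e / (4 * K * K * M))"
    have "c > 0" using that K \<open>M > 0\<close> by (simp add: c_def)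
    have c1: "K * c \<le> 1 / 2"
    proof -
      have "K * c \<le> K * (1 / (2 * K))" using K by (intro mult_left_mono) (auto simp: c_def)
      then show ?thesis using K by simp
    qed
    have c2: "K * c * (2 * K * M) \<le> e / 2"
    proof -
      have "K * c * (2 * K * M) \<le> K * (e / (4 * K * K * M)) * (2 * K * M)"
        using K \<open>M > 0\<close> by (intro mult_left_mono mult_right_mono) (auto simp: c_def)
      then show ?thesis using K \<open>M > 0\<close> by simp
    qed
    have e2: "e / (2 * K) > 0" using that K by simp
    from zder[OF zero_less_one] zder[OF e2] Fder[OF \<open>c > 0\<close>]
    show ?thesis
    proof eventually_elim
      case (elim s)
      define du where "du = u s - u t"
      define dz where "dz = F (u s) - F (u t)"
      define r where "r = dz - A du"
      have du: "du = P dz - P r"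
        by (simp add: r_def linear_diff[OF P(1)] PA)
      have r: "norm (P r) \<le> K * c * norm du"
      proof -
        have "norm (P r) \<le> norm r * K" by (rule K)
        also have "\<dots> \<le> c * norm du * K"
          using elim(3) K(1) by (intro mult_right_mono) (auto simp: r_def dz_def du_def)
        finally show ?thesis by (simp add: mult_ac)
      qed
      have "norm dz \<le> norm (dz - (s - t) *\<^sub>R z') + norm ((s - t) *\<^sub>R z')"
        by (metis diff_add_cancel norm_triangle_ineq)
      also have "\<dots> \<le> M * norm (s - t)"
        using elim(1) by (simp add: dz_def M_def distrib_right mult.commute[of "norm z'"])
      finally have dz: "norm dz \<le> M * norm (s - t)" .
      have "norm du \<le> norm (P dz) + norm (P r)" unfolding du by (rule norm_triangle_ineq4)
      also have "\<dots> \<le> norm dz * K + 1 / 2 * norm du"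
        using K(2)[of dz] r mult_right_mono[OF c1, of "norm du"] by simp
      finally have "norm du \<le> 2 * (norm dz * K)" by simp
      also have "\<dots> \<le> 2 * (M * norm (s - t) * K)"
        using dz K by (intro mult_left_mono mult_right_mono) auto
      finally have du': "norm du \<le> 2 * K * M * norm (s - t)" by (simp add: mult_ac)
      have "norm (du - (s - t) *\<^sub>R P z') = norm (P (dz - (s - t) *\<^sub>R z') - P r)"
        by (subst du, simp only: linear_diff[OF P(1)] linear_cmul[OF P(1)]) (simp add: algebra_simps)
      also have "\<dots> \<le> norm (P (dz - (s - t) *\<^sub>R z')) + norm (P r)" by (rule norm_triangle_ineq4)
      also have "\<dots> \<le> e / 2 * norm (s - t) + e / 2 * norm (s - t)"
      proof (rule add_mono)
        have "norm (P (dz - (s - t) *\<^sub>R z')) \<le> norm (dz - (s - t) *\<^sub>R z') * K" by (rule K)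
        also have "\<dots> \<le> e / (2 * K) * norm (s - t) * K"
          using elim(2) K by (intro mult_right_mono) (auto simp: dz_def)
        finally show "norm (P (dz - (s - t) *\<^sub>R z')) \<le> e / 2 * norm (s - t)" using K by simp
        have "norm (P r) \<le> K * c * (2 * K * M * norm (s - t))"
          using K \<open>c > 0\<close> by (intro order_trans[OF r mult_left_mono[OF du']]) simp
        also have "\<dots> \<le> e / 2 * norm (s - t)"
          using mult_right_mono[OF c2, of "norm (s - t)"] by (simp add: mult_ac)
        finally show "norm (P r) \<le> e / 2 * norm (s - t)" .
      qed
      also have "\<dots> = e * norm (s - t)" by simp
      finally show ?case by (simp add: du_def)
    qed
  qed
  then have "(u has_vector_derivative P z') (at t within J)"
    unfolding has_vector_derivative_def has_derivative_within_alt2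
    by (simp add: bounded_linear_scaleR_left)
  then show ?thesis ..
qed

text \<open>The Gram matrix turns the overdetermined system \<open>A v = z\<close> into a square invertible one.\<close>

lemma gram_det_nonzero:
  fixes A :: "real^'n::finite \<Rightarrow> 'b::euclidean_space"
  assumes "linear A" "inj A"
  shows "det (\<chi> a b. A (axis a 1) \<bullet> A (axis b 1) :: real^'n^'n) \<noteq> 0"
    and "(\<chi> a b. A (axis a 1) \<bullet> A (axis b 1) :: real^'n^'n) *v v = (\<chi> a. A (axis a 1) \<bullet> A v)"
proof -
  let ?G = "\<chi> a b. A (axis a 1) \<bullet> A (axis b 1) :: real^'n^'n"
  have G: "?G *v v = (\<chi> a. A (axis a 1) \<bullet> A v)" for v
  proof -
    have "A (axis a 1) \<bullet> A v = (\<Sum>b\<in>UNIV. A (axis a 1) \<bullet> A (axis b 1) * v $ b)" for a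
      by (subst linear_sum_axis[OF assms(1), of v]) (simp add: inner_sum_right mult.commute)
    then show ?thesis by (simp add: matrix_vector_mult_def)
  qed
  then show "?G *v v = (\<chi> a. A (axis a 1) \<bullet> A v)" .
  have "v = 0" if "?G *v v = 0" for v
  proof -
    have 0: "A (axis a 1) \<bullet> A v = 0" for a
      using that unfolding G by (simp add: vec_eq_iff)
    have "A v \<bullet> A v = (\<Sum>a\<in>UNIV. v $ a *\<^sub>R A (axis a 1)) \<bullet> A v"
      by (subst (1) linear_sum_axis[OF assms(1), of v]) simp
    also have "\<dots> = 0" by (simp add: inner_sum_left 0)
    finally have "A v = A 0" by (simp add: linear_0[OF assms(1)])
    with assms(2) show "v = 0" by (simp add: inj_eq)
  qed
  then have "invertible ?G"
    unfolding invertible_left_inverse matrix_left_invertible_ker by blast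
  then show "det ?G \<noteq> 0" by (simp add: invertible_det_nz)
qed

text \<open>By induction on \<open>k\<close>: the equation \<open>DF u' = z'\<close>, made square by the Gram matrix, expresses \<open>u'\<close>
  rationally by \<open>DF\<close> along \<open>u\<close> and by \<open>z'\<close>. These are of class \<open>C\<^sup>k\<close> if \<open>u\<close> is, so that \<open>u\<close> is then of
  class \<open>C\<^sup>k\<^sup>+\<^sup>1\<close>.\<close>

lemma immersion_reflects_smoothness:
  fixes F :: "real^'n::finite \<Rightarrow> real^'m::finite"
  assumes F: "smooth_on W F" and inj: "\<And>y. y \<in> W \<Longrightarrow> inj (frechet_derivative F (at y))"
    and u: "continuous_on J u" "u ` J \<subseteq> W"
    and z: "\<And>k. C_path k J (\<lambda>t. F (u t))"
    and J: "\<And>t. t \<in> J \<Longrightarrow> at t within J \<noteq> bot"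
  shows "C_path k J u"
proof -
  define DF where "DF t = frechet_derivative F (at (u t))" for t
  have DF: "(F has_derivative DF t) (at (u t))" "inj (DF t)" "linear (DF t)" if "t \<in> J" for t
  proof -
    show "(F has_derivative DF t) (at (u t))"
      unfolding DF_def by (rule smooth_on_has_derivative[OF F]) (use u that in auto)
    then show "linear (DF t)" by (rule has_derivative_linear)
    show "inj (DF t)" unfolding DF_def using inj u that by auto
  qed
  define z' where "z' t = vector_derivative (\<lambda>t. F (u t)) (at t within J)" for t
  have z': "((\<lambda>t. F (u t)) has_vector_derivative z' t) (at t within J)" if "t \<in> J" for t
    unfolding z'_def by (rule C_path_Suc_vector_derivative(1)[OF z J that])
  have z'_smooth: "C_path k J z'" for k
    unfolding z'_def by (rule C_path_Suc_vector_derivative(2)[OF z J])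
  have "\<exists>v. (u has_vector_derivative v) (at t within J)" if "t \<in> J" for t
    by (rule immersion_reflects_differentiability[OF DF(1,2)[OF that] _ z'[OF that]])
      (use u that in \<open>simp add: continuous_on_eq_continuous_within\<close>)
  then obtain u' where u': "\<And>t. t \<in> J \<Longrightarrow> (u has_vector_derivative u' t) (at t within J)" by metis
  have DFu': "DF t (u' t) = z' t" if "t \<in> J" for t
    by (rule vector_derivative_unique_within[OF J[OF that]
          has_vector_derivative_compose_has_derivative[OF u'[OF that] DF(1)[OF that]] z'[OF that]])
  show ?thesis
  proof (induction k)
    case 0
    then show ?case using u by simp
  next
    case (Suc k)
    have DF_C: "C_path k J (\<lambda>t. DF t h)" for h
      unfolding DF_def by (rule C_path_smooth_compose[OF u(2) smooth_on_frechet_derivative[OF F] Suc])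
    have "C_path k J u'"
    proof (rule C_path_cramer)
      fix i j
      show "C_path k J (\<lambda>t. (\<chi> a b. DF t (axis a 1) \<bullet> DF t (axis b 1) :: real^'n^'n) $ i $ j)"
        by (simp add: C_path_inner DF_C)
      show "C_path k J (\<lambda>t. (\<chi> a. DF t (axis a 1) \<bullet> z' t) $ i)"
        by (simp add: C_path_inner DF_C z'_smooth)
    next
      fix t assume "t \<in> J"
      show "det (\<chi> a b. DF t (axis a 1) \<bullet> DF t (axis b 1) :: real^'n^'n) \<noteq> 0"
        by (rule gram_det_nonzero(1)[OF DF(3,2)]) fact+
      show "(\<chi> a b. DF t (axis a 1) \<bullet> DF t (axis b 1) :: real^'n^'n) *v u' t = (\<chi> a. DF t (axis a 1) \<bullet> z' t)"
        by (simp add: gram_det_nonzero(2)[OF DF(3,2)] \<open>t \<in> J\<close> DFu')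
    qed
    with u' show ?case by auto
  qed
qed

section \<open>Charts and the tangent map of the inclusion\<close>

text \<open>What is needed of two charts in order to change coordinates from the first to the second. The
  dimensions may differ, so that this covers both the transitions within an atlas and the pairs
  formed by a chart of a submanifold and a chart of the ambient manifold.\<close>

definition compatible :: "('q, 'd::finite) chart \<Rightarrow> ('q, 'e::finite) chart \<Rightarrow> bool"
  where "compatible c c' \<longleftrightarrow>
    (\<forall>p\<in>dom_of c. chart_inv c (coords c p) = p) \<and> (\<forall>p\<in>dom_of c'. chart_inv c' (coords c' p) = p) \<and>
    open (coords c ` (dom_of c \<inter> dom_of c')) \<and>
    smooth_on (coords c ` (dom_of c \<inter> dom_of c')) (coords c' \<circ> chart_inv c)"

lemma chart_open_image:
  assumes "smooth_manifold M A" "c \<in> A" "openin (top_of_set M) D"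
  shows "open (coords c ` (dom_of c \<inter> D))"
proof -
  have c: "openin (top_of_set M) (dom_of c)" "open (coords c ` dom_of c)"
    "homeomorphism (dom_of c) (coords c ` dom_of c) (coords c) (chart_inv c)"
    using assms(1,2) unfolding smooth_manifold_def by auto
  have "openin (top_of_set (dom_of c)) (dom_of c \<inter> D)"
    using assms(3) c(1) by (meson inf_le1 openin_Int openin_imp_subset openin_subset_trans)
  from homeomorphism_imp_open_map[OF c(3) this] c(2) show ?thesis
    by (simp add: openin_open_eq)
qed

lemma chart_inv_coords:
  assumes "smooth_manifold M A" "c \<in> A" "p \<in> dom_of c"
  shows "chart_inv c (coords c p) = p"
  using assms unfolding smooth_manifold_def homeomorphism_def by blast

lemma compatible_charts:
  assumes "smooth_manifold M A" "c \<in> A" "c' \<in> A"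
  shows "compatible c c'"
proof -
  have "openin (top_of_set M) (dom_of c')"
    "smooth_on (coords c ` (dom_of c \<inter> dom_of c')) (coords c' \<circ> chart_inv c)"
    using assms unfolding smooth_manifold_def by auto
  then show ?thesis
    using chart_inv_coords[OF assms(1)] chart_open_image[OF assms(1,2)] assms(2,3)
    by (simp add: compatible_def)
qed

text \<open>The coordinate expression of the inclusion is the change of coordinates between the two charts,
  its source and target being sets of points of the same type.\<close>

lemma compatible_submanifold_chart:
  assumes N: "submanifold N AN Q AQ" and Q: "smooth_manifold Q AQ" and c: "c \<in> AN" "c' \<in> AQ"
  shows "compatible c c'"
proof -
  have N': "smooth_manifold N AN" "N \<subseteq> Q" "smooth_map N AN Q AQ id"
    using N by (auto simp: submanifold_def)
  have "openin (top_of_set Q) (dom_of c')" using Q c(2) by (simp add: smooth_manifold_def)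
  then have "openin (top_of_set N) (N \<inter> dom_of c')"
    using N'(2) by (auto simp: openin_open)
  from chart_open_image[OF N'(1) c(1) this]
  have "open (coords c ` (dom_of c \<inter> dom_of c'))"
    using N'(1) c(1) unfolding smooth_manifold_def
    by (metis Int_absorb2 Int_assoc Sup_upper image_eqI)
  moreover have "smooth_on (coords c ` (dom_of c \<inter> dom_of c')) (coords c' \<circ> chart_inv c)"
    using N'(3) c by (auto simp: smooth_map_def)
  ultimately show ?thesis
    using chart_inv_coords[OF N'(1) c(1)] chart_inv_coords[OF Q c(2)] by (simp add: compatible_def)
qed

definition chart_jacobian ::
  "('q, 'd::finite) chart \<Rightarrow> ('q, 'e::finite) chart \<Rightarrow> 'q \<Rightarrow> real^'d \<Rightarrow> real^'e"
  where "chart_jacobian c c' p = frechet_derivative (coords c' \<circ> chart_inv c) (at (coords c p))"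

lemma chart_jacobian:
  assumes "compatible c c'" "p \<in> dom_of c" "p \<in> dom_of c'"
  shows "((coords c' \<circ> chart_inv c) has_derivative chart_jacobian c c' p) (at (coords c p))"
  unfolding chart_jacobian_def
  by (rule smooth_on_has_derivative[where S = "coords c ` (dom_of c \<inter> dom_of c')"])
    (use assms in \<open>auto simp: compatible_def\<close>)

lemma has_derivative_chart_change:
  assumes c: "compatible c c'" "p \<in> dom_of c" "p \<in> dom_of c'"
    and f: "((f \<circ> chart_inv c') has_derivative D) (at (coords c' p))"
  shows "((f \<circ> chart_inv c) has_derivative (\<lambda>w. D (chart_jacobian c c' p w))) (at (coords c p))"
proof -
  have inv: "chart_inv c (coords c q) = q" if "q \<in> dom_of c" for q
    using c(1) that by (simp add: compatible_def)
  have inv': "chart_inv c' (coords c' q) = q" if "q \<in> dom_of c'" for q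
    using c(1) that by (simp add: compatible_def)
  have "(((f \<circ> chart_inv c') \<circ> (coords c' \<circ> chart_inv c)) has_derivative (D \<circ> chart_jacobian c c' p))
      (at (coords c p))"
    by (rule diff_chain_at[OF chart_jacobian[OF c]]) (simp add: inv c f)
  then have "((f \<circ> chart_inv c) has_derivative (D \<circ> chart_jacobian c c' p)) (at (coords c p))"
  proof (rule has_derivative_transform_within_open)
    show "open (coords c ` (dom_of c \<inter> dom_of c'))" using c(1) by (simp add: compatible_def)
    show "coords c p \<in> coords c ` (dom_of c \<inter> dom_of c')" using c by auto
  qed (auto simp: inv inv')
  then show ?thesis by (simp add: o_def)
qed

lemma chart_jacobian_compose:
  assumes "compatible c c'" "compatible c' c''" "p \<in> dom_of c" "p \<in> dom_of c'" "p \<in> dom_of c''"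
  shows "chart_jacobian c' c'' p (chart_jacobian c c' p w) = chart_jacobian c c'' p w"
  using fun_cong[OF frechet_derivative_at[OF has_derivative_chart_change[OF assms(1,3,4)
        chart_jacobian[OF assms(2,4,5)]]], of w]
  by (simp add: chart_jacobian_def[of c c''])

lemma chart_jacobian_self:
  assumes "compatible c c" "p \<in> dom_of c"
  shows "chart_jacobian c c p w = w"
proof -
  have "((coords c \<circ> chart_inv c) has_derivative (\<lambda>w. w)) (at (coords c p))"
  proof (rule has_derivative_transform_within_open[OF has_derivative_ident])
    show "open (coords c ` dom_of c)" using assms(1) by (simp add: compatible_def)
    show "y = (coords c \<circ> chart_inv c) y" if "y \<in> coords c ` dom_of c" for y
      using assms(1) that by (auto simp: compatible_def)
  qed (use assms(2) in auto)
  from frechet_derivative_at[OF this] show ?thesis by (simp add: chart_jacobian_def fun_eq_iff)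
qed

text \<open>Stated in terms of \<open>chart_jacobian\<close>, the components of a tangent vector are accessible to the
  chain rule \<open>chart_jacobian_compose\<close>.\<close>

lemma tangent_at_eq:
  "tangent_at A c p w = (p, \<lambda>c'. if c' \<in> A \<and> p \<in> dom_of c' then chart_jacobian c c' p w else 0)"
  unfolding tangent_at_def chart_jacobian_def ..

lemma tangent_at_in_tangent_space:
  assumes "smooth_manifold M A" "c \<in> A" "p \<in> dom_of c"
  shows "tangent_at A c p w \<in> tangent_space A p"
  using assms(2,3) compatible_charts[OF assms(1)]
  by (auto simp: tangent_space_def tangent_at_eq chart_jacobian_compose simp flip: chart_jacobian_def)

lemma tangent_at_chart_change:
  assumes "smooth_manifold M A" "c \<in> A" "c' \<in> A" "p \<in> dom_of c" "p \<in> dom_of c'"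
  shows "tangent_at A c' p (chart_jacobian c c' p w) = tangent_at A c p w"
  using assms(2-) compatible_charts[OF assms(1)]
  by (auto simp: tangent_at_eq chart_jacobian_compose fun_eq_iff)

lemma some_chart:
  assumes "smooth_manifold M A" "p \<in> M"
  shows "some_chart A p \<in> A" "p \<in> dom_of (some_chart A p)"
proof -
  have "\<exists>c. c \<in> A \<and> p \<in> dom_of c" using assms by (auto simp: smooth_manifold_def)
  from someI_ex[OF this] show "some_chart A p \<in> A" "p \<in> dom_of (some_chart A p)"
    by (auto simp: some_chart_def)
qed

lemma chart_dom_subset: "smooth_manifold M A \<Longrightarrow> c \<in> A \<Longrightarrow> dom_of c \<subseteq> M"
  by (auto simp: smooth_manifold_def)

lemma tangent_map_id_eq:
  "tangent_map A A' id X = (let p = fst X; c = some_chart A p in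
    (p, \<lambda>c'. if c' \<in> A' \<and> p \<in> dom_of c' then chart_jacobian c c' p (snd X c) else 0))"
  unfolding tangent_map_def chart_jacobian_def Let_def o_id id_apply ..

text \<open>The tangent map refers to an arbitrarily chosen chart of \<open>N\<close> around \<open>p\<close>; by the chain rule any chart
  \<open>c\<close> of \<open>N\<close> gives the same result.\<close>

lemma tangent_map_tangent_at:
  assumes N: "submanifold N AN Q AQ" and Q: "smooth_manifold Q AQ"
    and c: "c \<in> AN" "c' \<in> AQ" "p \<in> dom_of c" "p \<in> dom_of c'"
  shows "tangent_map AN AQ id (tangent_at AN c p w) = tangent_at AQ c' p (chart_jacobian c c' p w)"
proof -
  have N': "smooth_manifold N AN" using N by (simp add: submanifold_def)
  note comp = compatible_charts[OF N'] compatible_charts[OF Q] compatible_submanifold_chart[OF N Q]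
  have "p \<in> N" using chart_dom_subset[OF N' c(1)] c(3) by auto
  note c0 = some_chart[OF N' this]
  show ?thesis
    using c c0 comp
    by (auto simp: tangent_map_id_eq tangent_at_eq Let_def fun_eq_iff chart_jacobian_compose
        simp del: split_paired_All)
qed

text \<open>The immersion condition concerns the tangent map as a whole, that is, all charts simultaneously. As
  the components in one chart of \<open>Q\<close> determine the others, it can be tested in each chart separately.\<close>

lemma inj_chart_jacobian_submanifold:
  assumes N: "submanifold N AN Q AQ" and Q: "smooth_manifold Q AQ"
    and c: "c \<in> AN" "c' \<in> AQ" "p \<in> dom_of c" "p \<in> dom_of c'"
  shows "inj (chart_jacobian c c' p)"
proof (rule injI)
  fix v w assume eq: "chart_jacobian c c' p v = chart_jacobian c c' p w"
  have N': "smooth_manifold N AN" using N by (simp add: submanifold_def)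
  have "p \<in> N" using chart_dom_subset[OF N' c(1)] c(3) by auto
  then have "inj_on (tangent_map AN AQ id) (tangent_space AN p)"
    using N by (simp add: submanifold_def)
  moreover have "tangent_map AN AQ id (tangent_at AN c p v) = tangent_map AN AQ id (tangent_at AN c p w)"
    by (simp add: tangent_map_tangent_at[OF N Q c] eq)
  ultimately have "tangent_at AN c p v = tangent_at AN c p w"
    using tangent_at_in_tangent_space[OF N' c(1,3)] by (auto dest: inj_onD)
  then have "snd (tangent_at AN c p v) c = snd (tangent_at AN c p w) c" by simp
  then have "chart_jacobian c c p v = chart_jacobian c c p w"
    using c by (simp add: tangent_at_eq)
  then show "v = w"
    by (simp add: chart_jacobian_self[OF compatible_charts[OF N' c(1) c(1)] c(3)])
qed

section \<open>Differentials of the constraint functions\<close>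

text \<open>The annihilator of the range of \<open>A\<close> has dimension \<open>CARD('m) - CARD('n)\<close>. The vectors \<open>g \<alpha>\<close> lie in
  it and are independent, and there are as many of them, so they span it.\<close>

lemma in_span_of_annihilator:
  fixes A :: "real^'n::finite \<Rightarrow> real^'m::finite" and g :: "'k::finite \<Rightarrow> real^'m"
  assumes A: "linear A" "inj A" and card: "CARD('k) = CARD('m) - CARD('n)"
    and indep: "\<And>a. (\<Sum>\<alpha>\<in>UNIV. a \<alpha> *\<^sub>R g \<alpha>) = 0 \<Longrightarrow> \<forall>\<alpha>. a \<alpha> = 0"
    and g: "\<And>\<alpha> w. g \<alpha> \<bullet> A w = 0" and E: "\<And>w. E \<bullet> A w = 0"
  shows "\<exists>a. E = (\<Sum>\<alpha>\<in>UNIV. a \<alpha> *\<^sub>R g \<alpha>)"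
proof -
  have "inj g"
  proof (rule injI, rule ccontr)
    fix \<alpha> \<beta> assume eq: "g \<alpha> = g \<beta>" and neq: "\<alpha> \<noteq> \<beta>"
    have "(\<Sum>\<gamma>\<in>UNIV. (if \<gamma> = \<alpha> then 1 else if \<gamma> = \<beta> then - 1 else 0) *\<^sub>R g \<gamma>)
        = (\<Sum>\<gamma>\<in>{\<alpha>, \<beta>}. (if \<gamma> = \<alpha> then 1 else if \<gamma> = \<beta> then - 1 else 0) *\<^sub>R g \<gamma>)"
      by (rule sum.mono_neutral_right) auto
    also have "\<dots> = 0" using eq neq by auto
    finally have "\<forall>\<gamma>. (if \<gamma> = \<alpha> then 1 else if \<gamma> = \<beta> then - 1 else 0) = (0::real)"
      by (rule indep)
    then show False by (auto dest: spec[of _ \<alpha>])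
  qed
  then have sum_range: "(\<Sum>v\<in>range g. a v *\<^sub>R v) = (\<Sum>\<alpha>\<in>UNIV. a (g \<alpha>) *\<^sub>R g \<alpha>)" for a
    by (simp add: sum.reindex)
  have "independent (range g)"
  proof
    assume "dependent (range g)"
    then obtain a where a: "\<exists>v\<in>range g. a v \<noteq> 0" "(\<Sum>v\<in>range g. a v *\<^sub>R v) = 0"
      by (auto simp: dependent_finite)
    then have "\<forall>\<alpha>. a (g \<alpha>) = 0" by (intro indep) (simp add: sum_range)
    with a(1) show False by auto
  qed
  then have dim_g: "dim (span (range g)) = CARD('k)"
    by (simp add: dim_eq_card_independent card_image[OF \<open>inj g\<close>])
  define V where "V = {y \<in> UNIV. \<forall>x\<in>range A. orthogonal x y}"
  have "dim V + dim (range A) = dim (UNIV :: (real^'m) set)"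
    unfolding V_def using A(1)
    by (intro dim_subspace_orthogonal_to_vectors) (auto intro: linear_subspace_image)
  moreover have "dim (range A) = CARD('n)"
    using dim_image_eq[OF A(1), of UNIV] A(2) by simp
  ultimately have dim_V: "dim V = dim (span (range g))" using card dim_g by simp
  have "subspace V" using subspace_orthogonal_to_vectors[of "range A"] by (simp add: V_def)
  moreover have "span (range g) \<subseteq> V"
    using g \<open>subspace V\<close> by (intro span_minimal) (auto simp: V_def orthogonal_def inner_commute)
  ultimately have "span (range g) = V"
    by (intro subspace_dim_equal) (auto simp: dim_V simp del: dim_span)
  moreover have "E \<in> V" using E by (auto simp: V_def orthogonal_def inner_commute)
  ultimately obtain a where "E = (\<Sum>v\<in>range g. a v *\<^sub>R v)"
    by (auto simp: span_finite)
  then show ?thesis unfolding sum_range by (intro exI[of _ "\<lambda>\<alpha>. a (g \<alpha>)"])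
qed

lemma partial_chart_change:
  assumes c: "compatible c c'" "p \<in> dom_of c" "p \<in> dom_of c'"
    and f: "smooth_on (coords c' ` dom_of c') (f \<circ> chart_inv c')"
  shows "partial a (f \<circ> chart_inv c) (coords c p) =
    (\<Sum>i\<in>UNIV. partial i (f \<circ> chart_inv c') (coords c' p) * chart_jacobian c c' p (axis a 1) $ i)"
proof -
  let ?D = "frechet_derivative (f \<circ> chart_inv c') (at (coords c' p))"
  have D: "((f \<circ> chart_inv c') has_derivative ?D) (at (coords c' p))"
    by (rule smooth_on_has_derivative[OF f]) (use c in auto)
  have "partial a (f \<circ> chart_inv c) (coords c p) = ?D (chart_jacobian c c' p (axis a 1))"
    by (rule partial_eq_derivative[OF has_derivative_chart_change[OF c D]])
  also have "\<dots> = (\<Sum>i\<in>UNIV. chart_jacobian c c' p (axis a 1) $ i *\<^sub>R ?D (axis i 1))"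
    by (rule linear_sum_axis[OF has_derivative_linear[OF D]])
  finally show ?thesis by (simp add: partial_eq_derivative[OF D] mult.commute)
qed

text \<open>In the chart by which \<open>differential\<close> is defined, differentials act as the inner product with the
  coordinate gradient.\<close>

lemma gradients_independent:
  assumes M: "smooth_manifold M A" "p \<in> M" and \<phi>: "\<And>\<alpha>. smooth_function A (\<phi> \<alpha>)"
    and indep: "differentials_independent_at A \<phi> p" and c: "c = some_chart A p"
    and zero: "(\<Sum>\<alpha>\<in>UNIV. a \<alpha> *\<^sub>R (\<chi> i. partial i (\<phi> \<alpha> \<circ> chart_inv c) (coords c p))) = 0"
  shows "\<forall>\<alpha>. a \<alpha> = 0"
proof -
  have c': "c \<in> A" "p \<in> dom_of c" using some_chart[OF M] c by auto
  have "(\<Sum>\<alpha>\<in>UNIV. a \<alpha> * differential A (\<phi> \<alpha>) X) = 0" if X: "X \<in> tangent_space A p" for X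
  proof -
    have "differential A (\<phi> \<alpha>) X = (\<chi> i. partial i (\<phi> \<alpha> \<circ> chart_inv c) (coords c p)) \<bullet> snd X c" for \<alpha>
    proof -
      let ?D = "frechet_derivative (\<phi> \<alpha> \<circ> chart_inv c) (at (coords c p))"
      have D: "((\<phi> \<alpha> \<circ> chart_inv c) has_derivative ?D) (at (coords c p))"
        by (rule smooth_on_has_derivative[where S = "coords c ` dom_of c"])
          (use c' \<phi> in \<open>auto simp: smooth_function_def\<close>)
      have "differential A (\<phi> \<alpha>) X = ?D (snd X c)"
        using X by (auto simp: differential_def tangent_space_def c Let_def)
      also have "\<dots> = (\<Sum>i\<in>UNIV. snd X c $ i *\<^sub>R ?D (axis i 1))"
        by (rule linear_sum_axis[OF has_derivative_linear[OF D]])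
      finally show ?thesis by (simp add: inner_vec_def partial_eq_derivative[OF D] mult.commute)
    qed
    then have "(\<Sum>\<alpha>\<in>UNIV. a \<alpha> * differential A (\<phi> \<alpha>) X)
        = (\<Sum>\<alpha>\<in>UNIV. a \<alpha> *\<^sub>R (\<chi> i. partial i (\<phi> \<alpha> \<circ> chart_inv c) (coords c p))) \<bullet> snd X c"
      by (simp add: inner_sum_left)
    then show ?thesis by (simp add: zero)
  qed
  with indep show ?thesis unfolding differentials_independent_at_def by blast
qed

section \<open>Curves in a submanifold\<close>

text \<open>Time derivatives are unique, also the one-sided derivatives at the end points.\<close>

lemma at_within_relatively_open_interval:
  assumes "is_interval I" "interior I \<noteq> {}" "openin (top_of_set I) J" "t \<in> J"
  shows "at t within J \<noteq> (bot :: real filter)"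
proof -
  have "at t within J = at t within I" by (rule at_within_openin[OF assms(3,4)])
  moreover have "t islimpt I"
  proof -
    have "\<not> (\<exists>a. I = {a})" using assms(2) by auto
    moreover have "t \<in> I" using assms(3,4) openin_imp_subset by blast
    ultimately show ?thesis
      using connected_imp_perfect[OF is_interval_connected[OF assms(1)]] by blast
  qed
  ultimately show ?thesis by (simp add: trivial_limit_within)
qed

lemma openin_curve_preimage:
  assumes "continuous_on I x" "x ` I \<subseteq> M" "openin (top_of_set M) D"
  shows "openin (top_of_set I) (I \<inter> x -` D)"
  using assms by (intro continuous_openin_preimage[of I x M]) auto

lemma submanifold_chart_overlap_openin:
  assumes N: "submanifold N AN Q AQ" and Q: "smooth_manifold Q AQ" and c: "c \<in> AN" "c' \<in> AQ"
  shows "openin (top_of_set N) (dom_of c \<inter> dom_of c')"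
proof -
  have N': "smooth_manifold N AN" "N \<subseteq> Q" using N by (auto simp: submanifold_def)
  have "openin (top_of_set Q) (dom_of c')" using Q c(2) by (simp add: smooth_manifold_def)
  then have "openin (top_of_set N) (N \<inter> dom_of c')" using N'(2) by (auto simp: openin_open)
  moreover have "openin (top_of_set N) (dom_of c)" using N'(1) c(1) by (simp add: smooth_manifold_def)
  ultimately have "openin (top_of_set N) (dom_of c \<inter> (N \<inter> dom_of c'))" by (rule openin_Int[rotated])
  moreover have "dom_of c \<inter> (N \<inter> dom_of c') = dom_of c \<inter> dom_of c'"
    using chart_dom_subset[OF N'(1) c(1)] by auto
  ultimately show ?thesis by simp
qed

text \<open>From left to right the inclusion is composed with the curve; from right to left the inclusion, being
  an immersion, reflects smoothness. Smoothness in a fixed chart is checked locally in time, because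
  the charts of the other manifold have to be changed along the curve.\<close>

lemma smooth_curve_in_submanifold_iff:
  assumes N: "submanifold N AN Q AQ" and Q: "smooth_manifold Q AQ"
    and I: "is_interval I" "interior I \<noteq> {}"
  shows "smooth_curve N AN I x \<longleftrightarrow> smooth_curve Q AQ I x \<and> x ` I \<subseteq> N"
proof -
  have N': "smooth_manifold N AN" "N \<subseteq> Q" using N by (auto simp: submanifold_def)
  note comp = compatible_submanifold_chart[OF N Q]
  have domN: "openin (top_of_set N) (dom_of c)" if "c \<in> AN" for c
    using N'(1) that by (simp add: smooth_manifold_def)
  have domQ: "openin (top_of_set N) (N \<inter> dom_of c')" if "c' \<in> AQ" for c'
  proof -
    have "openin (top_of_set Q) (dom_of c')" using Q that by (simp add: smooth_manifold_def)
    then show ?thesis using N'(2) by (auto simp: openin_open)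
  qed
  have overlap: "openin (top_of_set I) (I \<inter> x -` (dom_of c \<inter> dom_of c'))"
    if "continuous_on I x" "x ` I \<subseteq> N" "c \<in> AN" "c' \<in> AQ" for c c'
    using openin_curve_preimage[OF that(1,2) submanifold_chart_overlap_openin[OF N Q that(3,4)]] .
  note perfect = at_within_relatively_open_interval[OF I]
  show ?thesis
  proof (intro iffI conjI)
    assume x: "smooth_curve N AN I x"
    then have x': "continuous_on I x" "x ` I \<subseteq> N" by (auto simp: smooth_curve_def)
    then show "x ` I \<subseteq> N" by simp
    have "smooth_path_on (I \<inter> x -` dom_of c') (coords c' \<circ> x)" if c': "c' \<in> AQ" for c'
    proof -
      have J: "openin (top_of_set I) (I \<inter> x -` dom_of c')"
      proof -
        have "I \<inter> x -` (N \<inter> dom_of c') = I \<inter> x -` dom_of c'" using x'(2) by auto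
        with openin_curve_preimage[OF x' domQ[OF c']] show ?thesis by simp
      qed
      show ?thesis
      proof (rule C_path_imp_smooth_path_on[OF C_path_local])
        fix t k assume t: "t \<in> I \<inter> x -` dom_of c'"
        then obtain c where c: "c \<in> AN" "x t \<in> dom_of c"
          using some_chart[OF N'(1), of "x t"] x'(2) by blast
        define J' where "J' = I \<inter> x -` (dom_of c \<inter> dom_of c')"
        have J': "openin (top_of_set I) J'" unfolding J'_def by (rule overlap[OF x' c(1) c'])
        have "smooth_path_on (I \<inter> x -` dom_of c) (coords c \<circ> x)"
          using x c(1) by (simp add: smooth_curve_def)
        then have "smooth_path_on J' (coords c \<circ> x)"
          by (rule smooth_path_on_subset) (auto simp: J'_def)
        from smooth_path_on_imp_C_path[OF this]
        have "C_path k J' (\<lambda>t. (coords c' \<circ> chart_inv c) ((coords c \<circ> x) t))"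
        proof (rule C_path_smooth_compose[rotated 2])
          show "(coords c \<circ> x) ` J' \<subseteq> coords c ` (dom_of c \<inter> dom_of c')" by (auto simp: J'_def)
          show "smooth_on (coords c ` (dom_of c \<inter> dom_of c')) (coords c' \<circ> chart_inv c)"
            using comp[OF c(1) c'] by (simp add: compatible_def)
        qed
        then have "C_path k J' (coords c' \<circ> x)"
          by (rule C_path_cong) (auto simp: J'_def chart_inv_coords[OF N'(1) c(1)])
        moreover have "openin (top_of_set (I \<inter> x -` dom_of c')) J'"
          using J' J by (auto simp: J'_def intro: openin_subset_trans)
        ultimately show "\<exists>J'. openin (top_of_set (I \<inter> x -` dom_of c')) J' \<and> t \<in> J' \<and> C_path k J' (coords c' \<circ> x)"
          using t c by (intro exI[of _ J']) (auto simp: J'_def)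
      qed (use perfect[OF J] in auto)
    qed
    with x' N'(2) show "smooth_curve Q AQ I x" by (auto simp: smooth_curve_def)
  next
    assume "smooth_curve Q AQ I x \<and> x ` I \<subseteq> N"
    then have x: "smooth_curve Q AQ I x" and x': "continuous_on I x" "x ` I \<subseteq> N"
      by (auto simp: smooth_curve_def)
    have "smooth_path_on (I \<inter> x -` dom_of c) (coords c \<circ> x)" if c: "c \<in> AN" for c
    proof -
      have J: "openin (top_of_set I) (I \<inter> x -` dom_of c)"
        by (rule openin_curve_preimage[OF x' domN[OF c]])
      show ?thesis
      proof (rule C_path_imp_smooth_path_on[OF C_path_local])
        fix t k assume t: "t \<in> I \<inter> x -` dom_of c"
        then obtain c' where c': "c' \<in> AQ" "x t \<in> dom_of c'"
          using some_chart[OF Q, of "x t"] x'(2) N'(2) by blast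
        define J' where "J' = I \<inter> x -` (dom_of c \<inter> dom_of c')"
        have J': "openin (top_of_set I) J'" unfolding J'_def by (rule overlap[OF x' c c'(1)])
        have "smooth_path_on (I \<inter> x -` dom_of c') (coords c' \<circ> x)"
          using x c'(1) by (simp add: smooth_curve_def)
        then have "smooth_path_on J' (coords c' \<circ> x)"
          by (rule smooth_path_on_subset) (auto simp: J'_def)
        from smooth_path_on_imp_C_path[OF this]
        have z: "C_path k J' (\<lambda>t. (coords c' \<circ> chart_inv c) ((coords c \<circ> x) t))" for k
          by (rule C_path_cong) (auto simp: J'_def chart_inv_coords[OF N'(1) c])
        have "C_path k J' (coords c \<circ> x)"
        proof (rule immersion_reflects_smoothness[where F = "coords c' \<circ> chart_inv c"
              and W = "coords c ` (dom_of c \<inter> dom_of c')", OF _ _ _ _ z perfect[OF J']])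
          show "smooth_on (coords c ` (dom_of c \<inter> dom_of c')) (coords c' \<circ> chart_inv c)"
            using comp[OF c c'(1)] by (simp add: compatible_def)
          show "inj (frechet_derivative (coords c' \<circ> chart_inv c) (at y))"
            if "y \<in> coords c ` (dom_of c \<inter> dom_of c')" for y
            using that inj_chart_jacobian_submanifold[OF N Q c c'(1)]
            by (auto simp flip: chart_jacobian_def)
          have "continuous_on (dom_of c) (coords c)"
            using N'(1) c by (auto simp: smooth_manifold_def homeomorphism_def)
          with x'(1) show "continuous_on J' (coords c \<circ> x)"
            unfolding J'_def by (intro continuous_on_compose) (auto intro: continuous_on_subset)
          show "(coords c \<circ> x) ` J' \<subseteq> coords c ` (dom_of c \<inter> dom_of c')" by (auto simp: J'_def)
        qed
        moreover have "openin (top_of_set (I \<inter> x -` dom_of c)) J'"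
          using J' J by (auto simp: J'_def intro: openin_subset_trans)
        ultimately show "\<exists>J'. openin (top_of_set (I \<inter> x -` dom_of c)) J' \<and> t \<in> J' \<and> C_path k J' (coords c \<circ> x)"
          using t c' by (intro exI[of _ J']) (auto simp: J'_def)
      qed (use perfect[OF J] in auto)
    qed
    with x' show "smooth_curve N AN I x" by (auto simp: smooth_curve_def)
  qed
qed

section \<open>Equivalence of the intrinsic and the constrained dynamics\<close>

text \<open>The hypothesis \<open>rel\<close> is the coordinate-free form of the relation between the Lagrangians. It holds
  for \<open>L\<close> and its extension if \<open>c\<close> is a chart of \<open>N\<close> and \<open>c'\<close> one of \<open>Q\<close>, and it holds for a single
  Lagrangian \<open>L = L'\<close> and two charts of the same manifold.\<close>

lemma euler_lagrange_chart_change: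
  assumes M: "smooth_manifold M A" and comp: "compatible c c'"
    and D: "openin (top_of_set M) (dom_of c \<inter> dom_of c')"
    and c: "c \<in> A" "c' \<in> A'"
    and L': "smooth_lagrangian A' L'"
    and rel: "\<And>p v. p \<in> dom_of c \<Longrightarrow> p \<in> dom_of c' \<Longrightarrow>
      L (tangent_at A c p v) = L' (tangent_at A' c' p (chart_jacobian c c' p v))"
    and I: "is_interval I" "interior I \<noteq> {}"
    and x: "smooth_curve M A I x"
    and t: "t \<in> I" "x t \<in> dom_of c" "x t \<in> dom_of c'"
  shows "euler_lagrange A L c I x t a =
    (\<Sum>i\<in>UNIV. euler_lagrange A' L' c' I x t i * chart_jacobian c c' (x t) (axis a 1) $ i)"
proof -
  let ?W = "coords c ` (dom_of c \<inter> dom_of c')" and ?u = "coords c \<circ> x"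
  define J where "J = I \<inter> x -` (dom_of c \<inter> dom_of c')"
  have inv: "\<And>p. p \<in> dom_of c \<Longrightarrow> chart_inv c (coords c p) = p"
    and inv': "\<And>p. p \<in> dom_of c' \<Longrightarrow> chart_inv c' (coords c' p) = p"
    and W: "open ?W" "smooth_on ?W (coords c' \<circ> chart_inv c)"
    using comp by (auto simp: compatible_def)
  have x': "continuous_on I x" "x ` I \<subseteq> M" using x by (auto simp: smooth_curve_def)
  have J: "openin (top_of_set I) J" unfolding J_def by (rule openin_curve_preimage[OF x' D])
  note perfect = at_within_relatively_open_interval[OF I]
  have "smooth_path_on (I \<inter> x -` dom_of c) ?u" using x c by (simp add: smooth_curve_def)
  then have "smooth_path_on J ?u" by (rule smooth_path_on_subset) (auto simp: J_def)
  \<comment> \<open>The Euler--Lagrange expression involves two derivatives of the curve.\<close>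
  then have "C_path (Suc (Suc 0)) J ?u" by (rule smooth_path_on_imp_C_path)
  then obtain u1 u2 where u: "\<And>s. s \<in> J \<Longrightarrow> (?u has_vector_derivative u1 s) (at s within J)"
    "\<And>s. s \<in> J \<Longrightarrow> (u1 has_vector_derivative u2 s) (at s within J)"
    by auto
  have t': "t \<in> J" using t by (simp add: J_def)
  have "coordinate_euler_lagrange (lagrangian_in A L c) I ?u t a =
    (\<Sum>i\<in>UNIV. coordinate_euler_lagrange (lagrangian_in A' L' c') I (coords c' \<circ> x) t i *
      frechet_derivative (coords c' \<circ> chart_inv c) (at (?u t)) (axis a 1) $ i)"
  proof (rule coordinate_euler_lagrange_related[OF W, where U' = "coords c' ` dom_of c'" and J = J and u' = u1 and u'' = "u2 t"])
    show "(coords c' \<circ> chart_inv c) ` ?W \<subseteq> coords c' ` dom_of c'" by (auto simp: inv)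
    show "smooth_on (coords c' ` dom_of c' \<times> UNIV) (lagrangian_in A' L' c')"
      using L' c by (simp add: smooth_lagrangian_def)
    show "lagrangian_in A L c (y, v) = lagrangian_in A' L' c' ((coords c' \<circ> chart_inv c) y,
        frechet_derivative (coords c' \<circ> chart_inv c) (at y) v)" if "y \<in> ?W" for y v
      using that by (auto simp: lagrangian_in_def inv inv' rel simp flip: chart_jacobian_def)
    show "at s within I \<noteq> bot" if "s \<in> I" for s
      using perfect[OF _ that] by simp
    show "?u s \<in> ?W" "(coords c' \<circ> x) s = (coords c' \<circ> chart_inv c) (?u s)" if "s \<in> J" for s
      using that by (auto simp: J_def inv)
    show "(?u has_vector_derivative u1 s) (at s within I)" if "s \<in> J" for s
      using u(1)[OF that] by (simp add: at_within_openin[OF J that])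
    show "(u1 has_vector_derivative u2 t) (at t within I)"
      using u(2)[OF t'] by (simp add: at_within_openin[OF J t'])
  qed (fact J t')+
  then show ?thesis by (simp add: euler_lagrange_eq_coordinate chart_jacobian_def)
qed

theorem proposition2p2:
  fixes Q N :: "'q::{t2_space,second_countable_topology} set"
    and AQ :: "('q, 'm::finite) chart set"
    and AN :: "('q, 'n::finite) chart set"
    and \<phi> :: "'k::finite \<Rightarrow> 'q \<Rightarrow> real"
    and L :: "('q, 'n) tangent_vector \<Rightarrow> real"
    and L' :: "('q, 'm) tangent_vector \<Rightarrow> real"
    and I :: "real set"
  assumes "smooth_manifold Q AQ"
    and "CARD('n) < CARD('m)"
    and "CARD('k) = CARD('m) - CARD('n)"
    and "\<And>\<alpha>. smooth_function AQ (\<phi> \<alpha>)"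
    and "N = {q\<in>Q. \<forall>\<alpha>. \<phi> \<alpha> q = 0}"
    and "\<And>p. p \<in> N \<Longrightarrow> differentials_independent_at AQ \<phi> p"
    and "submanifold N AN Q AQ"
    and "regular_lagrangian AN L"
    and "smooth_lagrangian AQ L'"
    and "\<And>X. X \<in> tangent_bundle N AN \<Longrightarrow> L' (tangent_map AN AQ id X) = L X"
    and "is_interval I" and "interior I \<noteq> {}"
  shows "(\<forall>x. smooth_curve N AN I x \<longrightarrow>
            (intrinsic_solution AN L I x \<longleftrightarrow>
             (\<exists>\<Lambda>. extrinsic_solution AQ L' \<phi> I \<Lambda> (id \<circ> x)))) \<and>
         (\<forall>q \<Lambda>. smooth_curve Q AQ I q \<and> extrinsic_solution AQ L' \<phi> I \<Lambda> q \<longrightarrow>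
            (\<exists>x. smooth_curve N AN I x \<and> (\<forall>t\<in>I. q t = (id \<circ> x) t)))"
proof -
  note Q = assms(1) and \<phi> = assms(4) and N = assms(7) and I = assms(11,12)
  have N': "smooth_manifold N AN" "N \<subseteq> Q" using N by (auto simp: submanifold_def)
  have zero: "\<phi> \<alpha> p = 0" if "p \<in> N" for \<alpha> p using that assms(5) by simp
  have \<phi>c: "smooth_on (coords c ` dom_of c) (\<phi> \<alpha> \<circ> chart_inv c)" if "c \<in> AQ" for c \<alpha>
    using \<phi> that by (simp add: smooth_function_def)
  have EL_pullback: "euler_lagrange AN L c I x t a =
      (\<Sum>i\<in>UNIV. euler_lagrange AQ L' c' I x t i * chart_jacobian c c' (x t) (axis a 1) $ i)"
    if x: "smooth_curve N AN I x" and c: "c \<in> AN" "c' \<in> AQ" and t: "t \<in> I" "x t \<in> dom_of c" "x t \<in> dom_of c'"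
    for x c c' t a
  proof (rule euler_lagrange_chart_change[OF N'(1) compatible_submanifold_chart[OF N Q c] _ c assms(9) _ I x t])
    show "openin (top_of_set N) (dom_of c \<inter> dom_of c')"
      by (rule submanifold_chart_overlap_openin[OF N Q c])
    fix p v assume p: "p \<in> dom_of c" "p \<in> dom_of c'"
    have "tangent_at AN c p v \<in> tangent_bundle N AN"
      using tangent_at_in_tangent_space[OF N'(1) c(1) p(1)] chart_dom_subset[OF N'(1) c(1)] p(1)
      by (auto simp: tangent_bundle_def)
    from assms(10)[OF this]
    show "L (tangent_at AN c p v) = L' (tangent_at AQ c' p (chart_jacobian c c' p v))"
      by (simp add: tangent_map_tangent_at[OF N Q c p])
  qed
  have EL_transition: "euler_lagrange AQ L' c I x t a =
      (\<Sum>i\<in>UNIV. euler_lagrange AQ L' c' I x t i * chart_jacobian c c' (x t) (axis a 1) $ i)"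
    if x: "smooth_curve Q AQ I x" and c: "c \<in> AQ" "c' \<in> AQ" and t: "t \<in> I" "x t \<in> dom_of c" "x t \<in> dom_of c'"
    for x c c' t a
  proof (rule euler_lagrange_chart_change[OF Q compatible_charts[OF Q c] _ c assms(9) _ I x t])
    show "openin (top_of_set Q) (dom_of c \<inter> dom_of c')"
      using Q c by (intro openin_Int) (auto simp: smooth_manifold_def)
    show "L' (tangent_at AQ c p v) = L' (tangent_at AQ c' p (chart_jacobian c c' p v))"
      if "p \<in> dom_of c" "p \<in> dom_of c'" for p v
      using tangent_at_chart_change[OF Q c that] by simp
  qed
  \<comment> \<open>In a chart of \<open>N\<close> the constraint functions vanish identically.\<close>
  have gradient_tangent: "(\<Sum>i\<in>UNIV. partial i (\<phi> \<alpha> \<circ> chart_inv c') (coords c' p) *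
      chart_jacobian c c' p (axis a 1) $ i) = 0"
    if c: "c \<in> AN" "c' \<in> AQ" and p: "p \<in> dom_of c" "p \<in> dom_of c'" for c c' p a \<alpha>
  proof -
    have comp: "compatible c c" by (rule compatible_charts[OF N'(1) c(1) c(1)])
    have "((\<phi> \<alpha> \<circ> chart_inv c) has_derivative (\<lambda>_. 0)) (at (coords c p))"
    proof (rule has_derivative_transform_within_open[OF has_derivative_const])
      show "open (coords c ` dom_of c)" using comp by (simp add: compatible_def)
      show "0 = (\<phi> \<alpha> \<circ> chart_inv c) y" if "y \<in> coords c ` dom_of c" for y
        using that comp chart_dom_subset[OF N'(1) c(1)] by (auto simp: compatible_def zero subset_iff)
    qed (use p in auto)
    from partial_eq_derivative[OF this, of a]
      partial_chart_change[OF compatible_submanifold_chart[OF N Q c] p \<phi>c[OF c(2)], of a \<alpha>]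
    show ?thesis by simp
  qed
  have "intrinsic_solution AN L I x \<longleftrightarrow> (\<exists>\<Lambda>. extrinsic_solution AQ L' \<phi> I \<Lambda> x)"
    if x: "smooth_curve N AN I x" for x
  proof
    have xN: "x t \<in> N" if "t \<in> I" for t using x that by (auto simp: smooth_curve_def)
    have xQ: "smooth_curve Q AQ I x"
      using x smooth_curve_in_submanifold_iff[OF N Q I] by blast
    \<comment> \<open>Independence of the differentials is expressed through \<open>some_chart\<close>, so this is the chart in
      which the multipliers at time \<open>t\<close> are determined.\<close>
    define C where "C t = some_chart AQ (x t)" for t
    have C: "C t \<in> AQ" "x t \<in> dom_of (C t)" if "t \<in> I" for t
      using some_chart[OF Q, of "x t"] xN[OF that] N'(2) by (auto simp: C_def)
    define g where "g t \<alpha> = (\<chi> i. partial i (\<phi> \<alpha> \<circ> chart_inv (C t)) (coords (C t) (x t)))" for t \<alpha>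
    assume sol: "intrinsic_solution AN L I x"
    have "\<exists>a. (\<chi> i. euler_lagrange AQ L' (C t) I x t i) = (\<Sum>\<alpha>\<in>UNIV. a \<alpha> *\<^sub>R g t \<alpha>)" if t: "t \<in> I" for t
    proof -
      obtain c where c: "c \<in> AN" "x t \<in> dom_of c"
        using some_chart[OF N'(1) xN[OF t]] by blast
      let ?A = "chart_jacobian c (C t) (x t)"
      have lin: "linear ?A"
        by (rule has_derivative_linear[OF chart_jacobian[OF compatible_submanifold_chart[OF N Q c(1) C(1)[OF t]] c(2) C(2)[OF t]]])
      have orth: "v \<bullet> ?A w = 0" if "\<And>a. v \<bullet> ?A (axis a 1) = 0" for v w
        by (subst linear_sum_axis[OF lin, of w]) (simp add: inner_sum_right that)
      show ?thesis
      proof (rule in_span_of_annihilator[OF lin _ assms(3)])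
        show "inj ?A" by (rule inj_chart_jacobian_submanifold[OF N Q c(1) C(1)[OF t] c(2) C(2)[OF t]])
        show "\<forall>\<alpha>. a \<alpha> = 0" if "(\<Sum>\<alpha>\<in>UNIV. a \<alpha> *\<^sub>R g t \<alpha>) = 0" for a
          by (rule gradients_independent[OF Q subsetD[OF N'(2) xN[OF t]] \<phi> assms(6)[OF xN[OF t]]
                C_def that[unfolded g_def]])
        show "g t \<alpha> \<bullet> ?A w = 0" for \<alpha> w
          by (rule orth)
            (simp add: g_def inner_vec_def gradient_tangent[OF c(1) C(1)[OF t] c(2) C(2)[OF t]])
        show "(\<chi> i. euler_lagrange AQ L' (C t) I x t i) \<bullet> ?A w = 0" for w
          by (rule orth) (use EL_pullback[OF x c(1) C(1)[OF t] t c(2) C(2)[OF t]] sol c t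
              in \<open>simp add: inner_vec_def intrinsic_solution_def\<close>)
      qed
    qed
    then obtain \<mu> where \<mu>: "\<And>t. t \<in> I \<Longrightarrow>
        (\<chi> i. euler_lagrange AQ L' (C t) I x t i) = (\<Sum>\<alpha>\<in>UNIV. \<mu> t \<alpha> *\<^sub>R g t \<alpha>)" by metis
    have EL_C: "euler_lagrange AQ L' (C t) I x t i =
        (\<Sum>\<alpha>\<in>UNIV. \<mu> t \<alpha> * partial i (\<phi> \<alpha> \<circ> chart_inv (C t)) (coords (C t) (x t)))" if "t \<in> I" for t i
      using arg_cong[OF \<mu>[OF that], of "\<lambda>v. v $ i"] by (simp add: g_def)
    \<comment> \<open>The same multipliers serve every chart \<open>c\<close>: both sides are pulled back by the transition from
      \<open>c\<close> to \<open>C t\<close>.\<close>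
    have "extrinsic_solution AQ L' \<phi> I (\<lambda>\<alpha> t. - \<mu> t \<alpha>) x"
      unfolding extrinsic_solution_def
    proof (intro conjI ballI allI impI)
      fix c t a assume c: "c \<in> AQ" and t: "t \<in> I" and xt: "x t \<in> dom_of c"
      have comp: "compatible c (C t)" by (rule compatible_charts[OF Q c C(1)[OF t]])
      let ?J = "\<lambda>i. chart_jacobian c (C t) (x t) (axis a 1) $ i"
      have "euler_lagrange AQ L' c I x t a = (\<Sum>i\<in>UNIV. euler_lagrange AQ L' (C t) I x t i * ?J i)"
        by (rule EL_transition[OF xQ c C(1)[OF t] t xt C(2)[OF t]])
      also have "\<dots> = (\<Sum>i\<in>UNIV. \<Sum>\<alpha>\<in>UNIV.
          \<mu> t \<alpha> * (partial i (\<phi> \<alpha> \<circ> chart_inv (C t)) (coords (C t) (x t)) * ?J i))"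
        by (simp add: EL_C[OF t] sum_distrib_right mult.assoc)
      also have "\<dots> = (\<Sum>\<alpha>\<in>UNIV. \<mu> t \<alpha> *
          (\<Sum>i\<in>UNIV. partial i (\<phi> \<alpha> \<circ> chart_inv (C t)) (coords (C t) (x t)) * ?J i))"
        by (subst sum.swap) (simp add: sum_distrib_left)
      also have "\<dots> = (\<Sum>\<alpha>\<in>UNIV. \<mu> t \<alpha> * partial a (\<phi> \<alpha> \<circ> chart_inv c) (coords c (x t)))"
        by (simp add: partial_chart_change[OF comp xt C(2)[OF t] \<phi>c[OF C(1)[OF t]]])
      finally show "euler_lagrange AQ L' c I x t a =
          - (\<Sum>\<alpha>\<in>UNIV. - \<mu> t \<alpha> * partial a (\<phi> \<alpha> \<circ> chart_inv c) (coords c (x t)))"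
        by (simp add: sum_negf)
    qed (simp add: zero xN)
    then show "\<exists>\<Lambda>. extrinsic_solution AQ L' \<phi> I \<Lambda> x" by blast
  next
    assume "\<exists>\<Lambda>. extrinsic_solution AQ L' \<phi> I \<Lambda> x"
    then obtain \<Lambda> where sol: "extrinsic_solution AQ L' \<phi> I \<Lambda> x" ..
    show "intrinsic_solution AN L I x" unfolding intrinsic_solution_def
    proof (intro ballI allI impI)
      fix c t a assume c: "c \<in> AN" and t: "t \<in> I" and xt: "x t \<in> dom_of c"
      have "x t \<in> Q" using chart_dom_subset[OF N'(1) c] xt N'(2) by auto
      then obtain c' where c': "c' \<in> AQ" "x t \<in> dom_of c'" using some_chart[OF Q] by blast
      let ?J = "\<lambda>i. chart_jacobian c c' (x t) (axis a 1) $ i"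
      have EL: "euler_lagrange AQ L' c' I x t i =
          - (\<Sum>\<alpha>\<in>UNIV. \<Lambda> \<alpha> t * partial i (\<phi> \<alpha> \<circ> chart_inv c') (coords c' (x t)))" for i
        using sol c' t by (simp add: extrinsic_solution_def)
      have "euler_lagrange AN L c I x t a = (\<Sum>i\<in>UNIV. euler_lagrange AQ L' c' I x t i * ?J i)"
        by (rule EL_pullback[OF x c c'(1) t xt c'(2)])
      also have "\<dots> = - (\<Sum>i\<in>UNIV. \<Sum>\<alpha>\<in>UNIV.
          \<Lambda> \<alpha> t * (partial i (\<phi> \<alpha> \<circ> chart_inv c') (coords c' (x t)) * ?J i))"
        by (simp add: EL sum_distrib_right mult.assoc sum_negf)
      also have "\<dots> = - (\<Sum>\<alpha>\<in>UNIV. \<Lambda> \<alpha> t *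
          (\<Sum>i\<in>UNIV. partial i (\<phi> \<alpha> \<circ> chart_inv c') (coords c' (x t)) * ?J i))"
        by (subst sum.swap) (simp add: sum_distrib_left)
      also have "\<dots> = 0" by (simp add: gradient_tangent[OF c c'(1) xt c'(2)])
      finally show "euler_lagrange AN L c I x t a = 0" .
    qed
  qed
  moreover have "smooth_curve N AN I q"
    if q: "smooth_curve Q AQ I q" "extrinsic_solution AQ L' \<phi> I \<Lambda> q" for q \<Lambda>
  proof -
    have "q ` I \<subseteq> N"
      using q unfolding assms(5) by (auto simp: smooth_curve_def extrinsic_solution_def)
    with q(1) show ?thesis using smooth_curve_in_submanifold_iff[OF N Q I] by blast
  qed
  ultimately show ?thesis by (auto simp: o_def)
qed

end
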